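(* Let $\mathcal{M}=(S,f,\Delta_S)$ be a cycling $2$-machine (not necessarily deterministic). Then there exist $\mathcal{M}$-good digraphs of arbitrarily large chromatic number if and only if the directed path $P_n$ is $\mathcal{M}$-good for every $n\ge 1$. Moreover, whether this condition holds can be decided in time polynomial in the size of $\mathcal{M}$.
   Context: $[k]=\{1,\dots,k\}$, $\mathcal{P}(S)$ is the power set of $S$, $\Delta_S=\{(s,s):s\in S\}$. A digraph is a pair $(V,E)$ with $E\subseteq V^2$ and no edge of the form $(v,v)$; its chromatic number is the least $\chi$ (possibly infinite) such that some map $c:V\to[\chi]$ has $c(a)\ne c(b)$ for all $(a,b)\in E$. $P_n$ is the digraph $([n+1],\{(i,i+1):1\le i\le n\})$. A $2$-machine is a triple $\mathcal{M}=(S,f,\mathcal{B})$ with $S$ finite, $f:S\times[2]^2\to\mathcal{P}(S)$, $\mathcal{B}\subseteq S\times S$; it is cycling if $\mathcal{B}=\Delta_S$. A cycle of a digraph $(V,E)$ is a sequence $c=(v_0,e_1,v_1,\dots,e_n,v_n)$ with $v_n=v_0$, $e_i\in E$, $v_{i-1},v_i$ among the coordinates of $e_i$; $|c|=n$; the trace is $\mathrm{tr}(c,i)=(a,b)$ where $(e_i)_a=v_{i-1}$, $(e_i)_b=v_i$. For a cycling machine, $c$ is $\mathcal{M}$-bad if $|c|>0$ and there are $s_0,\dots,s_n\in S$ with $s_i\in f(s_{i-1},\mathrm{tr}(c,i))$ for all $1\le i\le n$ and $s_n=s_0$. A digraph is $\mathcal{M}$-good if it has no $\mathcal{M}$-bad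 cycle. *)

theory Defs
  imports
    "Graph_Theory.Pair_Digraph"
    "HOL-Library.Extended_Nat"
    "HOL-Library.FuncSet"
    "HOL-Computational_Algebra.Polynomial"
begin

section \<open>Digraphs\<close>

text \<open>A digraph \<open>(V, E)\<close> without edges of the form \<open>(v, v)\<close>, of any cardinality, is a
  \<^locale>\<open>pair_loopfree_digraph\<close>.\<close>

text \<open>The infimum over the empty set is \<open>\<infinity>\<close>.\<close>
definition chromatic_number :: "'v pair_pre_digraph \<Rightarrow> enat" where
  "chromatic_number G =
     Inf {enat k | k. \<exists>c \<in> pverts G \<rightarrow> {1..k}. \<forall>(a, b) \<in> parcs G. c a \<noteq> c b}"

definition dipath :: "nat \<Rightarrow> nat pair_pre_digraph" where
  "dipath n = \<lparr>pverts = {1..n + 1}, parcs = {(i, i + 1) | i. 1 \<le> i \<and> i \<le> n}\<rparr>"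

section \<open>Cycles and traces\<close>

text \<open>The sequence \<open>(v\<^sub>0, e\<^sub>1, v\<^sub>1, \<dots>, e\<^sub>n, v\<^sub>n)\<close> is represented by the pair of lists
  \<open>([v\<^sub>0, \<dots>, v\<^sub>n], [e\<^sub>1, \<dots>, e\<^sub>n])\<close>.\<close>
type_synonym 'v vertex_edge_seq = "'v list \<times> ('v \<times> 'v) list"

definition vertex_at :: "'v vertex_edge_seq \<Rightarrow> nat \<Rightarrow> 'v" where
  "vertex_at c i = fst c ! i"

definition edge_at :: "'v vertex_edge_seq \<Rightarrow> nat \<Rightarrow> 'v \<times> 'v" where
  "edge_at c i = snd c ! (i - 1)"

definition cycle_length :: "'v vertex_edge_seq \<Rightarrow> nat" where
  "cycle_length c = length (snd c)"

definition coord :: "'v \<times> 'v \<Rightarrow> nat \<Rightarrow> 'v" where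
  "coord e a = (if a = 1 then fst e else snd e)"

text \<open>Consecutive vertices may coincide: an edge may be entered and left at the same coordinate.\<close>
definition is_cycle :: "'v pair_pre_digraph \<Rightarrow> 'v vertex_edge_seq \<Rightarrow> bool" where
  "is_cycle G c \<longleftrightarrow>
     length (fst c) = cycle_length c + 1 \<and>
     set (fst c) \<subseteq> pverts G \<and>
     vertex_at c (cycle_length c) = vertex_at c 0 \<and>
     (\<forall>i \<in> {1..cycle_length c}.
        edge_at c i \<in> parcs G \<and>
        vertex_at c (i - 1) \<in> coord (edge_at c i) ` {1, 2} \<and>
        vertex_at c i \<in> coord (edge_at c i) ` {1, 2})"

text \<open>The pair is unique because the two coordinates of an edge differ.\<close>
definition cycle_trace :: "'v vertex_edge_seq \<Rightarrow> nat \<Rightarrow> nat \<times> nat" where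
  "cycle_trace c i =
     (THE (a, b). a \<in> {1, 2} \<and> b \<in> {1, 2} \<and>
        coord (edge_at c i) a = vertex_at c (i - 1) \<and>
        coord (edge_at c i) b = vertex_at c i)"

section \<open>Machines\<close>

text \<open>The arguments of \<open>trans\<close> that matter are the states and the pairs in \<open>{1, 2} \<times> {1, 2}\<close>.\<close>
record 's machine =
  states :: "'s set"
  trans :: "'s \<Rightarrow> nat \<times> nat \<Rightarrow> 's set"
  boundary :: "('s \<times> 's) set"

definition two_machine :: "'s machine \<Rightarrow> bool" where
  "two_machine M \<longleftrightarrow>
     finite (states M) \<and>
     (\<forall>s \<in> states M. \<forall>ab \<in> {1, 2} \<times> {1, 2}. trans M s ab \<subseteq> states M) \<and>
     boundary M \<subseteq> states M \<times> states M"

definition cycling :: "'s machine \<Rightarrow> bool" where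
  "cycling M \<longleftrightarrow> boundary M = Id_on (states M)"

text \<open>Badness with respect to a cycling machine.\<close>
definition bad_cycle :: "'s machine \<Rightarrow> 'v vertex_edge_seq \<Rightarrow> bool" where
  "bad_cycle M c \<longleftrightarrow>
     cycle_length c > 0 \<and>
     (\<exists>s :: nat \<Rightarrow> 's.
        (\<forall>i \<le> cycle_length c. s i \<in> states M) \<and>
        (\<forall>i \<in> {1..cycle_length c}. s i \<in> trans M (s (i - 1)) (cycle_trace c i)) \<and>
        s (cycle_length c) = s 0)"

definition good :: "'s machine \<Rightarrow> 'v pair_pre_digraph \<Rightarrow> bool" where
  "good M G \<longleftrightarrow> (\<forall>c. is_cycle G c \<longrightarrow> \<not> bad_cycle M c)"

section \<open>Polynomial time\<close>

text \<open>The model of computation is the random access machine with a read-only binary input and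
  unit-cost instructions. Since the only arithmetic is addition and truncated subtraction, a
  \<open>t\<close>-step run of a fixed program only produces numbers of \<open>O(t)\<close> bits, so polynomial time is
  the same class as for Turing machines.\<close>

datatype instr =
    Const nat nat
  | Add nat nat nat
  | Sub nat nat nat
  | Load nat nat
  | Store nat nat
  | Read nat nat
  | JumpZero nat nat
  | Accept
  | Reject

text \<open>A configuration consists of the program counter and the registers.\<close>
type_synonym config = "nat \<times> (nat \<Rightarrow> nat)"

text \<open>The symbol \<open>2\<close> marks the end of the input.\<close>
definition input_symbol :: "bool list \<Rightarrow> nat \<Rightarrow> nat" where
  "input_symbol w i = (if i < length w then of_bool (w ! i) else 2)"

fun exec :: "bool list \<Rightarrow> instr \<Rightarrow> config \<Rightarrow> config" where
  "exec w (Const x n) (pc, m) = (pc + 1, m(x := n))"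
| "exec w (Add x y z) (pc, m) = (pc + 1, m(x := m y + m z))"
| "exec w (Sub x y z) (pc, m) = (pc + 1, m(x := m y - m z))"
| "exec w (Load x y) (pc, m) = (pc + 1, m(x := m (m y)))"
| "exec w (Store x y) (pc, m) = (pc + 1, m(m x := m y))"
| "exec w (Read x y) (pc, m) = (pc + 1, m(x := input_symbol w (m y)))"
| "exec w (JumpZero x l) (pc, m) = (if m x = 0 then l else pc + 1, m)"
| "exec w Accept (pc, m) = (pc, m)"
| "exec w Reject (pc, m) = (pc, m)"

definition step :: "instr list \<Rightarrow> bool list \<Rightarrow> config \<Rightarrow> config" where
  "step P w cf = (if fst cf < length P then exec w (P ! fst cf) cf else cf)"

text \<open>Within \<open>t\<close> steps the program has reached the halting instruction \<open>h\<close>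
  (\<open>Accept\<close> or \<open>Reject\<close>), where it then stays.\<close>
definition halts_within :: "instr list \<Rightarrow> bool list \<Rightarrow> nat \<Rightarrow> instr \<Rightarrow> bool" where
  "halts_within P w t h \<longleftrightarrow>
     (let pc = fst ((step P w ^^ t) (0, \<lambda>_. 0)) in pc < length P \<and> P ! pc = h)"

text \<open>A decision problem is given by a set \<open>I\<close> of instances, an encoding of them as binary words,
  and the property to be decided.\<close>
definition decidable_in_poly_time ::
    "'i set \<Rightarrow> ('i \<Rightarrow> bool list) \<Rightarrow> ('i \<Rightarrow> bool) \<Rightarrow> bool" where
  "decidable_in_poly_time I enc Q \<longleftrightarrow>
     (\<exists>(P :: instr list) (p :: nat poly). \<forall>x \<in> I.
        halts_within P (enc x) (poly p (length (enc x))) (if Q x then Accept else Reject))"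

text \<open>A cycling machine is presented by a list of its states. Its encoding is the number of states
  in unary, followed by the table of the transition function. The third component of a
  cycling machine is determined by the first. The length is \<open>4 * n\<^sup>2 + n + 1\<close> for \<open>n\<close> states.\<close>
definition presented_cycling_machines :: "('s machine \<times> 's list) set" where
  "presented_cycling_machines =
     {(M, xs). two_machine M \<and> cycling M \<and> distinct xs \<and> set xs = states M}"

definition encode_machine :: "'s machine \<times> 's list \<Rightarrow> bool list" where
  "encode_machine = (\<lambda>(M, xs).
     replicate (length xs) True @ [False] @
     [t \<in> trans M s ab. s \<leftarrow> xs, ab \<leftarrow> [(1, 1), (1, 2), (2, 1), (2, 2)], t \<leftarrow> xs])"

end

theory Submission
  imports Defs "HOL-Library.Ramsey" "HOL-Library.Countable"
begin

text \<open>Give the trace \<open>(a, b)\<close> the weight \<open>b - a\<close>, so that \<open>M\<close> becomes a digraph on its states with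
  edge weights in \<open>{-1, 0, 1}\<close>. A cycle of a directed path has total weight \<open>0\<close>, and hence all
  directed paths are good iff no nonempty closed walk of states has weight \<open>0\<close>.

  If some path \<open>P\<^sub>n\<close> is bad, then no good digraph contains a directed walk with \<open>n\<close> edges, so
  colouring a vertex by the length of the longest directed walk from it uses at most \<open>n\<close> colours.
  Conversely, if there is no closed walk of weight \<open>0\<close>, then along a bad cycle all closed
  subwalks of states have weights of one sign, hence the height of the walk never moves against
  this sign by \<open>|S|\<close> or more. In the shift graph of increasing \<open>r\<close>-tuples with \<open>r > |S|\<close>, such a walk
  drifts to larger (or smaller) entries and cannot close up, while the chromatic number is infinite by
  Ramsey's theorem.

  The pairs of states joined by a walk of weight \<open>0\<close> form the least reflexive relation \<open>Y\<close> that is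
  closed under composition on the left with blocks, a block being an edge of weight \<open>0\<close> or a pair of
  \<open>Y\<close> enclosed by edges of weights \<open>1\<close> and \<open>-1\<close> in either order. The decision procedure computes
  \<open>Y\<close> by saturation: each of \<open>n\<^sup>2 + 1\<close> sweeps adds a pair unless \<open>Y\<close> is complete already.\<close>

section \<open>Traced runs\<close>

definition trace_weight :: "nat \<times> nat \<Rightarrow> int" where
  "trace_weight ab = int (snd ab) - int (fst ab)"

text \<open>The trace is carried as data \<open>\<tau>\<close>, so that the definite description in
  \<open>cycle_trace\<close> is dealt with only once; \<open>\<tau> i\<close> belongs to the step
  from time \<open>i\<close> to \<open>Suc i\<close>. The closing conditions are stated separately
  where they are needed.\<close>

definition traced_run ::
    "'s machine \<Rightarrow> 'v pair_pre_digraph \<Rightarrow> nat \<Rightarrow> (nat \<Rightarrow> 'v) \<Rightarrow> (nat \<Rightarrow> 's) \<Rightarrow> (nat \<Rightarrow> nat \<times> nat) \<Rightarrow> bool"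
  where
  "traced_run M G n v s \<tau> \<longleftrightarrow>
     (\<forall>i \<le> n. s i \<in> states M) \<and>
     (\<forall>i < n. \<tau> i \<in> {1, 2} \<times> {1, 2} \<and> s (Suc i) \<in> trans M (s i) (\<tau> i) \<and>
        (\<exists>e \<in> parcs G. coord e (fst (\<tau> i)) = v i \<and> coord e (snd (\<tau> i)) = v (Suc i)))"

text \<open>Distinct coordinates make \<open>coord\<close> injective on \<open>{1, 2}\<close>, so
  the pair described by \<open>THE\<close> is unique.\<close>

lemma cycle_trace_eq:
  assumes "fst (edge_at c i) \<noteq> snd (edge_at c i)" "a \<in> {1, 2}" "b \<in> {1, 2}"
    "coord (edge_at c i) a = vertex_at c (i - 1)" "coord (edge_at c i) b = vertex_at c i"
  shows "cycle_trace c i = (a, b)"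
proof -
  have inj: "x = y" if "coord (edge_at c i) x = coord (edge_at c i) y" "x \<in> {1, 2}" "y \<in> {1, 2}" for x y
    using that assms(1) by (auto simp: coord_def split: if_splits)
  show ?thesis
    unfolding cycle_trace_def
  proof (rule the_equality)
    show "case (a, b) of (a, b) \<Rightarrow> a \<in> {1, 2} \<and> b \<in> {1, 2} \<and>
        coord (edge_at c i) a = vertex_at c (i - 1) \<and> coord (edge_at c i) b = vertex_at c i"
      using assms by simp
  next
    fix p
    assume "case p of (a, b) \<Rightarrow> a \<in> {1, 2} \<and> b \<in> {1, 2} \<and>
        coord (edge_at c i) a = vertex_at c (i - 1) \<and> coord (edge_at c i) b = vertex_at c i"
    then show "p = (a, b)"
      using inj[of "fst p" a] inj[of "snd p" b] assms(2-5) by (cases p) simp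
  qed
qed

text \<open>Converts between the list encoding of cycles and functions of time. In one direction
  coordinates are chosen on each edge, in the other the functions are tabulated as lists.\<close>

lemma not_good_iff_traced_run:
  assumes "pair_loopfree_digraph G"
  shows "\<not> good M G \<longleftrightarrow>
    (\<exists>n v s \<tau>. 0 < n \<and> traced_run M G n v s \<tau> \<and> v n = v 0 \<and> s n = s 0)"
proof
  interpret pair_loopfree_digraph G by fact
  assume "\<not> good M G"
  then obtain c s where c: "is_cycle G c" and pos: "cycle_length c > 0"
    and s: "\<forall>i \<le> cycle_length c. s i \<in> states M"
      "\<forall>i \<in> {1..cycle_length c}. s i \<in> trans M (s (i - 1)) (cycle_trace c i)"
      "s (cycle_length c) = s 0"
    unfolding good_def bad_cycle_def by blast
  let ?n = "cycle_length c"
  have "cycle_trace c (Suc i) \<in> {1, 2} \<times> {1, 2} \<and>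
      s (Suc i) \<in> trans M (s i) (cycle_trace c (Suc i)) \<and>
      (\<exists>e \<in> parcs G. coord e (fst (cycle_trace c (Suc i))) = vertex_at c i \<and>
         coord e (snd (cycle_trace c (Suc i))) = vertex_at c (Suc i))" if "i < ?n" for i
  proof -
    have mem: "Suc i \<in> {1..?n}"
      using that by simp
    from c have "\<forall>i \<in> {1..?n}. edge_at c i \<in> parcs G \<and>
        vertex_at c (i - 1) \<in> coord (edge_at c i) ` {1, 2} \<and>
        vertex_at c i \<in> coord (edge_at c i) ` {1, 2}"
      unfolding is_cycle_def by blast
    from bspec[OF this mem] have e: "edge_at c (Suc i) \<in> parcs G"
      and im: "vertex_at c i \<in> coord (edge_at c (Suc i)) ` {1, 2}"
        "vertex_at c (Suc i) \<in> coord (edge_at c (Suc i)) ` {1, 2}"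
      by simp_all
    from im obtain a b where ab: "a \<in> {1, 2}" "b \<in> {1, 2}"
      "coord (edge_at c (Suc i)) a = vertex_at c i" "coord (edge_at c (Suc i)) b = vertex_at c (Suc i)"
      by (elim imageE) metis
    then have tr: "cycle_trace c (Suc i) = (a, b)"
      using pair_no_loops[OF e] by (intro cycle_trace_eq) simp_all
    have "s (Suc i) \<in> trans M (s i) (cycle_trace c (Suc i))"
      using bspec[OF s(2) mem] by simp
    then show ?thesis
      using e ab tr by auto
  qed
  then have "traced_run M G ?n (vertex_at c) s (\<lambda>i. cycle_trace c (Suc i))"
    using s(1) unfolding traced_run_def by blast
  moreover have "vertex_at c ?n = vertex_at c 0"
    using c unfolding is_cycle_def by blast
  ultimately show "\<exists>n v s \<tau>. 0 < n \<and> traced_run M G n v s \<tau> \<and> v n = v 0 \<and> s n = s 0"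
    using pos s(3) by blast
next
  interpret pair_loopfree_digraph G by fact
  assume "\<exists>n v s \<tau>. 0 < n \<and> traced_run M G n v s \<tau> \<and> v n = v 0 \<and> s n = s 0"
  then obtain n v s \<tau> where n: "0 < n" and run: "traced_run M G n v s \<tau>"
    and closed: "v n = v 0" "s n = s 0"
    by blast
  obtain e where e: "\<And>i. i < n \<Longrightarrow> e i \<in> parcs G \<and> coord (e i) (fst (\<tau> i)) = v i \<and>
      coord (e i) (snd (\<tau> i)) = v (Suc i)"
    using run unfolding traced_run_def by metis
  have \<tau>: "fst (\<tau> i) \<in> {1, 2}" "snd (\<tau> i) \<in> {1, 2}" if "i < n" for i
    using run that unfolding traced_run_def by (metis mem_Times_iff)+
  define c where "c = (map v [0..<Suc n], map e [0..<n])"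
  have len: "cycle_length c = n"
    by (simp add: c_def cycle_length_def)
  have vertex: "vertex_at c i = v i" if "i \<le> n" for i
    using that by (simp add: c_def vertex_at_def del: upt_Suc)
  have edge: "edge_at c (Suc i) = e i" if "i < n" for i
    using that by (simp add: c_def edge_at_def)
  have coord_in: "coord d a \<in> pverts G" if "d \<in> parcs G" for d a
    using that arc_fst_in_verts arc_snd_in_verts by (simp add: coord_def)
  have v_in: "v i \<in> pverts G" if "i \<le> n" for i
  proof (cases "i < n")
    case True
    then show ?thesis using e coord_in by metis
  next
    \<comment> \<open>No step starts at time \<open>n\<close>, so the last vertex is identified with
      the first one by closedness.\<close>
    case False
    then have "v i = v 0" using that closed by simp
    then show ?thesis using e[OF n] coord_in by metis
  qed
  have "is_cycle G c"
    unfolding is_cycle_def len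
  proof (intro conjI ballI)
    show "length (fst c) = n + 1" by (simp add: c_def)
    show "set (fst c) \<subseteq> pverts G" using v_in by (auto simp: c_def)
    show "vertex_at c n = vertex_at c 0" using closed vertex by simp
    fix i assume "i \<in> {1..n}"
    then obtain j where j: "i = Suc j" "j < n"
      by (cases i) auto
    show "edge_at c i \<in> parcs G" using j edge e by simp
    show "vertex_at c (i - 1) \<in> coord (edge_at c i) ` {1, 2}"
      using j edge e[OF j(2)] vertex[of j] \<tau>[OF j(2)] by (metis diff_Suc_1 image_eqI less_imp_le)
    show "vertex_at c i \<in> coord (edge_at c i) ` {1, 2}"
      using j edge e[OF j(2)] vertex[of "Suc j"] \<tau>[OF j(2)] by (metis Suc_leI image_eqI)
  qed
  moreover have "bad_cycle M c"
    unfolding bad_cycle_def len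
  proof (intro conjI exI[of _ s] ballI)
    fix i assume "i \<in> {1..n}"
    then obtain j where j: "i = Suc j" "j < n"
      by (cases i) auto
    have "cycle_trace c i = (fst (\<tau> j), snd (\<tau> j))"
      using e[OF j(2)] \<tau>[OF j(2)] edge[OF j(2)] vertex[of j] vertex[of "Suc j"] j pair_no_loops
      by (intro cycle_trace_eq) simp_all
    then show "s i \<in> trans M (s (i - 1)) (cycle_trace c i)"
      using run j unfolding traced_run_def by simp
  qed (use n closed run in \<open>auto simp: traced_run_def\<close>)
  ultimately show "\<not> good M G"
    unfolding good_def by blast
qed

text \<open>The image of an edge meets the images of the visited vertices in the same coordinates,
  so a bad cycle of \<open>G\<close> is carried to a bad cycle of \<open>G'\<close> with the same
  trace and states.\<close>

lemma good_homomorphism: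
  assumes "pair_loopfree_digraph G" "pair_loopfree_digraph G'" "good M G'"
    and hom: "\<And>a b. (a, b) \<in> parcs G \<Longrightarrow> (h a, h b) \<in> parcs G'"
  shows "good M G"
proof (rule ccontr)
  assume "\<not> good M G"
  then obtain n v s \<tau> where n: "0 < n" "v n = v 0" "s n = s 0" and run: "traced_run M G n v s \<tau>"
    using assms(1) not_good_iff_traced_run by blast
  have "\<exists>e \<in> parcs G'. coord e a = h (coord d a) \<and> coord e b = h (coord d b)"
    if "d \<in> parcs G" for d a b
    using hom[of "fst d" "snd d"] that
    by (intro bexI[of _ "(h (fst d), h (snd d))"]) (auto simp: coord_def)
  then have "\<exists>e \<in> parcs G'. coord e (fst (\<tau> i)) = h (v i) \<and> coord e (snd (\<tau> i)) = h (v (Suc i))"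
    if "i < n" for i
    using run that unfolding traced_run_def by metis
  then have "traced_run M G' n (\<lambda>i. h (v i)) s \<tau>"
    using run unfolding traced_run_def by blast
  then have "\<not> good M G'"
    unfolding not_good_iff_traced_run[OF assms(2)] using n
    by (intro exI[of _ n] exI[of _ "\<lambda>i. h (v i)"] exI[of _ s] exI[of _ \<tau>]) simp
  then show False
    using assms(3) by contradiction
qed

section \<open>Walks in the weighted state graph\<close>

inductive walk :: "('a \<Rightarrow> int \<Rightarrow> 'a \<Rightarrow> bool) \<Rightarrow> 'a \<Rightarrow> int \<Rightarrow> 'a \<Rightarrow> bool"
  for E where
  walk_nil: "walk E s 0 s"
| walk_step: "E s z t \<Longrightarrow> walk E t z' u \<Longrightarrow> walk E s (z + z') u"

text \<open>Splitting off the first edge excludes the empty walk.\<close>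

definition zero_cycle :: "('a \<Rightarrow> int \<Rightarrow> 'a \<Rightarrow> bool) \<Rightarrow> bool" where
  "zero_cycle E \<longleftrightarrow> (\<exists>s z t. E s z t \<and> walk E t (- z) s)"

definition state_edge :: "'s machine \<Rightarrow> 's \<Rightarrow> int \<Rightarrow> 's \<Rightarrow> bool" where
  "state_edge M s z t \<longleftrightarrow> s \<in> states M \<and> t \<in> states M \<and>
     (\<exists>ab \<in> {1, 2} \<times> {1, 2}. t \<in> trans M s ab \<and> z = trace_weight ab)"

lemma state_edge_weight: "state_edge M s z t \<Longrightarrow> z \<in> {-1, 0, 1}"
  by (auto simp: state_edge_def trace_weight_def)

lemma walk_single: "E s z t \<Longrightarrow> walk E s z t"
  using walk_step[of E s z t 0 t] walk_nil[of E t] by simp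

lemma walk_append: "walk E s z t \<Longrightarrow> walk E t z' u \<Longrightarrow> walk E s (z + z') u"
  by (induction rule: walk.induct) (auto intro: walk_step simp: add.assoc)

lemma walk_repeat: "walk E s z s \<Longrightarrow> walk E s (int k * z) s"
proof (induction k)
  case (Suc k)
  then show ?case using walk_append[of E s z s "int k * z" s] by (simp add: algebra_simps)
qed (simp add: walk_nil)

text \<open>\<open>H\<close> is a height function along the sequence, and the weights
  telescope.\<close>

lemma walk_segment:
  assumes "\<And>k. i \<le> k \<Longrightarrow> k < j \<Longrightarrow> E (s k) (H (Suc k) - H k) (s (Suc k))" "i \<le> j"
  shows "walk E (s i) (H j - H i) (s j)"
  using assms(2,1)
proof (induction j rule: dec_induct)
  case base
  then show ?case by (simp add: walk_nil)
next
  case (step j)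
  have "walk E (s i) (H j - H i) (s j)" using step by simp
  from walk_append[OF this walk_single[of E "s j" "H (Suc j) - H j"]] step
  show ?case by simp
qed

lemma zero_cycle_of_segment:
  assumes "\<And>k. i \<le> k \<Longrightarrow> k < j \<Longrightarrow> E (s k) (H (Suc k) - H k) (s (Suc k))" "i < j"
    "s i = s j" "H i = H j"
  shows "zero_cycle E"
proof -
  have "E (s i) (H (Suc i) - H i) (s (Suc i))" using assms(1,2) by blast
  moreover have "walk E (s (Suc i)) (H j - H (Suc i)) (s j)"
    using assms by (intro walk_segment) auto
  ultimately show ?thesis
    unfolding zero_cycle_def using assms by (metis minus_diff_eq)
qed

text \<open>Run through the closed walk of weight \<open>z\<close> \<open>p\<close> times and through that of weight \<open>p\<close> \<open>-z\<close> times.\<close>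
lemma zero_cycle_of_opposite_signs:
  assumes "walk E s p s" "walk E s z s" "p > 0" "z \<le> 0" "E s z' t" "walk E t (z - z') s"
  shows "zero_cycle E"
proof -
  \<comment> \<open>One of the \<open>p\<close> passes through the walk of weight \<open>z\<close>
    is the one opened at its first edge \<open>E s z' t\<close>, hence \<open>p - 1\<close>.\<close>
  have 1: "walk E s (int (nat (- z)) * p) s" "walk E s (int (nat (p - 1)) * z) s"
    using assms walk_repeat by metis+
  have "walk E t (z - z' + (int (nat (p - 1)) * z + int (nat (- z)) * p)) s"
    using walk_append[OF assms(6) walk_append[OF 1(2) 1(1)]] by (simp add: algebra_simps)
  moreover have "z - z' + (int (nat (p - 1)) * z + int (nat (- z)) * p) = - z'"
    using assms by (simp add: algebra_simps)
  ultimately show ?thesis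
    unfolding zero_cycle_def using assms(5) by metis
qed

text \<open>Unrolls the inductive walk into the indexed form that \<open>traced_run\<close> needs;
  \<open>case_nat\<close> prepends one step.\<close>

lemma walk_imp_sequence:
  assumes "walk (state_edge M) s z t" "s \<in> states M"
  shows "\<exists>n \<sigma> \<tau>. \<sigma> 0 = s \<and> \<sigma> n = t \<and> (\<forall>i \<le> n. \<sigma> i \<in> states M) \<and>
    (\<forall>i < n. \<tau> i \<in> {1, 2} \<times> {1, 2} \<and> \<sigma> (Suc i) \<in> trans M (\<sigma> i) (\<tau> i)) \<and>
    (\<Sum>i<n. trace_weight (\<tau> i)) = z"
  using assms
proof (induction rule: walk.induct)
  case (walk_nil s)
  then show ?case by (intro exI[of _ 0] exI[of _ "\<lambda>_. s"]) auto
next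
  case (walk_step s z t z' u)
  then obtain ab where ab: "ab \<in> {1, 2} \<times> {1, 2}" "t \<in> trans M s ab" "z = trace_weight ab"
    and t: "t \<in> states M"
    unfolding state_edge_def by blast
  obtain n \<sigma> \<tau> where *: "\<sigma> 0 = t" "\<sigma> n = u" "\<forall>i \<le> n. \<sigma> i \<in> states M"
    "\<forall>i < n. \<tau> i \<in> {1, 2} \<times> {1, 2} \<and> \<sigma> (Suc i) \<in> trans M (\<sigma> i) (\<tau> i)"
    "(\<Sum>i<n. trace_weight (\<tau> i)) = z'"
    using walk_step.IH[OF t] by blast
  have "(\<Sum>i<Suc n. trace_weight (case_nat ab \<tau> i)) = z + z'"
    unfolding sum.lessThan_Suc_shift using * ab by simp
  then show ?case
    using * ab walk_step.prems
    by (intro exI[of _ "Suc n"] exI[of _ "case_nat s \<sigma>"] exI[of _ "case_nat ab \<tau>"])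
      (auto split: nat.split simp: less_Suc_eq_0_disj)
qed

section \<open>Cycles of directed paths and closed state walks of weight zero\<close>

lemma pair_loopfree_dipath: "pair_loopfree_digraph (dipath n)"
  by unfold_locales (auto simp: dipath_def)

text \<open>The number of the current path vertex serves as the height: since arcs have the form
  \<open>(i, i + 1)\<close>, a step with trace \<open>(a, b)\<close> changes it by
  \<open>b - a\<close>.\<close>

lemma zero_cycle_of_not_good_dipath:
  assumes "\<not> good M (dipath n)"
  shows "zero_cycle (state_edge M)"
proof -
  obtain k v s \<tau> where k: "0 < k" "v k = v 0" "s k = s 0" and run: "traced_run M (dipath n) k v s \<tau>"
    using assms not_good_iff_traced_run pair_loopfree_dipath by blast
  have "state_edge M (s i) (int (v (Suc i)) - int (v i)) (s (Suc i))" if "i < k" for i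
  proof -
    from run that obtain e where e: "e \<in> parcs (dipath n)"
      "coord e (fst (\<tau> i)) = v i" "coord e (snd (\<tau> i)) = v (Suc i)"
      and \<tau>: "\<tau> i \<in> {1, 2} \<times> {1, 2}" "s (Suc i) \<in> trans M (s i) (\<tau> i)"
      unfolding traced_run_def by blast
    have "int (v (Suc i)) - int (v i) = trace_weight (\<tau> i)"
      using e \<tau>(1) by (auto simp: dipath_def coord_def trace_weight_def)
    then show ?thesis
      using run that \<tau> unfolding state_edge_def traced_run_def by (metis Suc_leI less_imp_le)
  qed
  then show ?thesis
    using zero_cycle_of_segment[of 0 k "state_edge M" s "\<lambda>i. int (v i)"] k by simp
qed

text \<open>The closed state walk is replayed on a long path, started near its middle; the partial
  sums of the weights give the positions.\<close>

lemma not_good_dipath_of_zero_cycle: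
  assumes "zero_cycle (state_edge M)"
  shows "\<exists>n \<ge> 1. \<not> good M (dipath n)"
proof -
  obtain s z t where st: "state_edge M s z t" "walk (state_edge M) t (- z) s"
    using assms unfolding zero_cycle_def by blast
  from st(1) obtain ab where ab: "ab \<in> {1, 2} \<times> {1, 2}" "t \<in> trans M s ab" "z = trace_weight ab"
    and s: "s \<in> states M" and t: "t \<in> states M"
    unfolding state_edge_def by blast
  obtain n \<sigma> \<tau> where *: "\<sigma> 0 = t" "\<sigma> n = s" "\<forall>i \<le> n. \<sigma> i \<in> states M"
    "\<forall>i < n. \<tau> i \<in> {1, 2} \<times> {1, 2} \<and> \<sigma> (Suc i) \<in> trans M (\<sigma> i) (\<tau> i)"
    "(\<Sum>i<n. trace_weight (\<tau> i)) = - z"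
    using walk_imp_sequence[OF st(2) t] by (elim exE conjE) (rule that)
  define \<sigma>' \<tau>' where "\<sigma>' = case_nat s \<sigma>" and "\<tau>' = case_nat ab \<tau>"
  define H where "H i = (\<Sum>k<i. trace_weight (\<tau>' k))" for i
  let ?n = "Suc n"
  have \<tau>': "\<tau>' i \<in> {1, 2} \<times> {1, 2} \<and> \<sigma>' (Suc i) \<in> trans M (\<sigma>' i) (\<tau>' i)" if "i < ?n" for i
    using * ab that by (cases i) (auto simp: \<sigma>'_def \<tau>'_def)
  have \<sigma>': "\<sigma>' i \<in> states M" if "i \<le> ?n" for i
    using * s that by (cases i) (auto simp: \<sigma>'_def)
  have Hn: "H ?n = 0"
    unfolding H_def \<tau>'_def sum.lessThan_Suc_shift using * ab by simp
  have H_bound: "\<bar>H i\<bar> \<le> int i" if "i \<le> ?n" for i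
    using that
  proof (induction i)
    case (Suc i)
    moreover have "\<bar>trace_weight (\<tau>' i)\<bar> \<le> 1"
      using \<tau>'[of i] Suc.prems by (auto simp: trace_weight_def)
    ultimately show ?case by (simp add: H_def)
  qed (simp add: H_def)
  \<comment> \<open>\<open>\<bar>H i\<bar> \<le> n + 1\<close> puts \<open>v i\<close> between
    \<open>2\<close> and \<open>2 * n + 4\<close>, so that the arcs on both sides of it exist in
    \<open>dipath (2 * n + 4)\<close>.\<close>
  define v where "v i = nat (H i + int n + 3)" for i
  have v: "int (v i) = H i + int n + 3" "2 \<le> v i" "v i \<le> 2 * n + 4" if "i \<le> ?n" for i
    using H_bound[OF that] that by (auto simp: v_def)
  have "\<exists>e \<in> parcs (dipath (2 * n + 4)).
      coord e (fst (\<tau>' i)) = v i \<and> coord e (snd (\<tau>' i)) = v (Suc i)" if "i < ?n" for i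
  proof -
    \<comment> \<open>The entry coordinate alone determines the arc; for a trace of weight
      \<open>0\<close> the walk leaves it where it entered.\<close>
    define e where "e = (if fst (\<tau>' i) = 1 then (v i, v i + 1) else (v i - 1, v i))"
    have i: "i \<le> ?n" "Suc i \<le> ?n" using that by auto
    have "int (v (Suc i)) = int (v i) + trace_weight (\<tau>' i)"
      using v(1)[OF i(1)] v(1)[OF i(2)] by (simp add: H_def)
    then have "coord e (fst (\<tau>' i)) = v i \<and> coord e (snd (\<tau>' i)) = v (Suc i)"
      using \<tau>'[OF that] v(2)[OF i(1)] by (auto simp: e_def coord_def trace_weight_def)
    moreover have "e \<in> parcs (dipath (2 * n + 4))"
      using v(2,3)[OF i(1)] by (auto simp: e_def dipath_def)
    ultimately show ?thesis by blast
  qed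
  then have "traced_run M (dipath (2 * n + 4)) ?n v \<sigma>' \<tau>'"
    using \<tau>' \<sigma>' unfolding traced_run_def by blast
  moreover have "v ?n = v 0" "\<sigma>' ?n = \<sigma>' 0"
    using Hn * by (auto simp: v_def H_def \<sigma>'_def)
  ultimately have "\<not> good M (dipath (2 * n + 4))"
    unfolding not_good_iff_traced_run[OF pair_loopfree_dipath] by blast
  then show ?thesis
    by (intro exI[of _ "2 * n + 4"]) simp
qed

lemma all_dipaths_good_iff:
  "(\<forall>n \<ge> 1. good M (dipath n)) \<longleftrightarrow> \<not> zero_cycle (state_edge M)"
  using zero_cycle_of_not_good_dipath[of M] not_good_dipath_of_zero_cycle[of M] by metis

section \<open>Digraphs without long directed walks\<close>

primrec starts_walk :: "'v pair_pre_digraph \<Rightarrow> nat \<Rightarrow> 'v \<Rightarrow> bool" where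
  "starts_walk G 0 v \<longleftrightarrow> True"
| "starts_walk G (Suc k) v \<longleftrightarrow> (\<exists>u. (v, u) \<in> parcs G \<and> starts_walk G k u)"

lemma starts_walk_sequence:
  "starts_walk G k v \<Longrightarrow> \<exists>h. h 0 = v \<and> (\<forall>i < k. (h i, h (Suc i)) \<in> parcs G)"
proof (induction k arbitrary: v)
  case (Suc k)
  then obtain u where u: "(v, u) \<in> parcs G" "starts_walk G k u"
    by auto
  obtain h where "h 0 = u" "\<forall>i < k. (h i, h (Suc i)) \<in> parcs G"
    using Suc.IH[OF u(2)] by blast
  then show ?case
    using u(1) by (intro exI[of _ "case_nat v h"]) (auto simp: less_Suc_eq_0_disj)
qed auto

text \<open>Colour \<open>v\<close> by one more than the length of a longest directed walk from
  \<open>v\<close>. A walk from \<open>b\<close> extends along an arc \<open>(a, b)\<close> to a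
  longer one from \<open>a\<close>, so the colours of \<open>a\<close> and \<open>b\<close>
  differ.\<close>

lemma chromatic_number_le_of_no_walk:
  assumes "\<And>v. \<not> starts_walk G n v"
  shows "chromatic_number G \<le> enat n"
proof -
  define c where "c v = (LEAST k. \<not> starts_walk G k v)" for v
  have c: "\<not> starts_walk G (c v) v" for v
    unfolding c_def using assms by (rule LeastI)
  have c_less: "starts_walk G k v" if "k < c v" for k v
    using not_less_Least[OF that[unfolded c_def]] by simp
  have "c v \<le> n" for v
    unfolding c_def using assms by (rule Least_le)
  moreover have c_pos: "c v \<noteq> 0" for v
    using c[of v] by (cases "c v") auto
  moreover have "c a \<noteq> c b" if "(a, b) \<in> parcs G" for a b
  proof
    assume eq: "c a = c b"
    obtain j where j: "c a = Suc j"
      using c_pos not0_implies_Suc by blast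
    then have "starts_walk G j b"
      using c_less[of j b] eq by simp
    then have "starts_walk G (Suc j) a"
      using that by auto
    then show False using c[of a] j by simp
  qed
  ultimately have "c \<in> pverts G \<rightarrow> {1..n}" "\<forall>(a, b) \<in> parcs G. c a \<noteq> c b"
    by (auto simp: Pi_iff Suc_le_eq)
  then show ?thesis
    unfolding chromatic_number_def by (intro Inf_lower) blast
qed

text \<open>A directed walk with \<open>n\<close> edges in \<open>G\<close> is a homomorphism from
  \<open>dipath n\<close> to \<open>G\<close>, along which goodness would be pulled back.\<close>

lemma chromatic_number_le_of_good:
  assumes "pair_loopfree_digraph G" "good M G" "\<not> good M (dipath n)"
  shows "chromatic_number G \<le> enat n"
proof (rule chromatic_number_le_of_no_walk, rule notI)
  fix v assume v: "starts_walk G n v"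
  obtain h where h: "\<forall>i < n. (h i, h (Suc i)) \<in> parcs G"
    using starts_walk_sequence[OF v] by blast
  have "good M (dipath n)"
  proof (rule good_homomorphism[OF pair_loopfree_dipath assms(1,2)])
    fix a b assume "(a, b) \<in> parcs (dipath n)"
    then have "b = Suc a" "1 \<le> a" "a \<le> n" by (auto simp: dipath_def)
    \<comment> \<open>Path vertices are numbered from \<open>1\<close>, the vertices of the walk
      \<open>h\<close> from \<open>0\<close>.\<close>
    then show "(h (a - 1), h (b - 1)) \<in> parcs G"
      using h[rule_format, of "a - 1"] by simp
  qed
  then show False using assms(3) by contradiction
qed

section \<open>Shift graphs\<close>

definition shift_graph :: "nat \<Rightarrow> nat list pair_pre_digraph" where
  "shift_graph r = \<lparr>pverts = {xs. length xs = r \<and> sorted_wrt (<) xs},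
     parcs = {(xs, ys). length xs = r \<and> sorted_wrt (<) xs \<and> length ys = r \<and> sorted_wrt (<) ys \<and>
       (\<forall>k. Suc k < r \<longrightarrow> xs ! Suc k = ys ! k)}\<rparr>"

text \<open>Along an arc the second entry of the source is the first entry of the target, so the
  first entries differ. For \<open>r < 2\<close> the matching condition is void and loops
  appear.\<close>

lemma pair_loopfree_shift_graph:
  assumes "r \<ge> 2"
  shows "pair_loopfree_digraph (shift_graph r)"
proof
  fix e assume "e \<in> parcs (shift_graph r)"
  then have e: "length (fst e) = r" "sorted_wrt (<) (fst e)" "fst e ! 1 = snd e ! 0"
    using assms by (auto simp: shift_graph_def)
  have "fst e ! 0 < fst e ! 1"
    using assms e by (intro sorted_wrt_nth_less[of "(<)"]) auto
  then show "fst e \<noteq> snd e" using e(3) by auto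
qed (auto simp: shift_graph_def)

text \<open>Ramsey's theorem for \<open>r\<close>-subsets gives an infinite monochromatic
  \<open>Y\<close>. Among \<open>r + 1\<close> elements of \<open>Y\<close> the first
  \<open>r\<close> and the last \<open>r\<close> form an arc whose ends have the same
  colour.\<close>

lemma shift_graph_not_colourable:
  fixes c :: "nat list \<Rightarrow> nat"
  assumes "c \<in> pverts (shift_graph r) \<rightarrow> {1..k}"
  shows "\<exists>(xs, ys) \<in> parcs (shift_graph r). c xs = c ys"
proof -
  have sl: "sorted_list_of_set X \<in> pverts (shift_graph r)" if "card X = r" for X
    using that by (simp add: shift_graph_def)
  have "\<forall>X::nat set. X \<subseteq> UNIV \<and> finite X \<and> card X = r \<longrightarrow> c (sorted_list_of_set X) < Suc k"
    using assms sl by (fastforce simp: Pi_iff)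
  from Ramsey[OF infinite_UNIV_nat this] obtain Y t where Y: "infinite Y"
    and t: "\<And>X. X \<subseteq> Y \<Longrightarrow> finite X \<Longrightarrow> card X = r \<Longrightarrow> c (sorted_list_of_set X) = t"
    by metis
  obtain X where X: "X \<subseteq> Y" "finite X" "card X = Suc r"
    using infinite_arbitrarily_large[OF Y] by blast
  define zs where "zs = sorted_list_of_set X"
  have zs: "length zs = Suc r" "sorted_wrt (<) zs" "set zs = X"
    using X by (simp_all add: zs_def)
  have colour: "c xs = t" if "length xs = r" "sorted_wrt (<) xs" "set xs \<subseteq> X" for xs
  proof -
    have d: "distinct xs" "sorted xs" using that strict_sorted_iff by blast+
    then have "xs = sorted_list_of_set (set xs)"
      by (simp add: sorted_distinct_set_unique)
    moreover have "card (set xs) = r" using that d distinct_card by blast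
    ultimately show ?thesis
      using t[of "set xs"] that X by auto
  qed
  have "length (take r zs) = r" "sorted_wrt (<) (take r zs)" "set (take r zs) \<subseteq> X"
    "length (drop 1 zs) = r" "sorted_wrt (<) (drop 1 zs)" "set (drop 1 zs) \<subseteq> X"
    using zs set_take_subset[of r zs] set_drop_subset[of 1 zs]
    by (auto simp: sorted_wrt_take sorted_wrt_drop)
  moreover from this have "(take r zs, drop 1 zs) \<in> parcs (shift_graph r)"
    using zs by (simp add: shift_graph_def)
  ultimately show ?thesis
    using colour by (metis (mono_tags, lifting) case_prodI)
qed

text \<open>If the height fell by \<open>card S\<close>, the first times of reaching depths
  \<open>0, \<dots>, card S\<close> below \<open>H i\<close> would be \<open>card S + 1\<close>
  increasing times with falling heights. By \<open>mono\<close> their states are distinct, against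
  the pigeonhole principle.\<close>

lemma drop_less_card:
  fixes H :: "nat \<Rightarrow> int" and s :: "nat \<Rightarrow> 's"
  assumes S: "finite S" "\<And>i. s i \<in> S"
    and step: "\<And>i. \<bar>H (Suc i) - H i\<bar> \<le> 1"
    and mono: "\<And>i j. i < j \<Longrightarrow> s i = s j \<Longrightarrow> H i < H j"
    and "i \<le> j"
  shows "H i - int (card S) < H j"
proof (rule ccontr)
  assume "\<not> ?thesis"
  then have j: "H j \<le> H i - int (card S)" by simp
  define P where "P k t \<longleftrightarrow> i \<le> t \<and> H t \<le> H i - int k" for k t
  define f where "f k = (LEAST t. P k t)" for k
  have Pj: "P k j" if "k \<le> card S" for k
    using that j \<open>i \<le> j\<close> by (simp add: P_def)
  have Pf: "P k (f k)" if "k \<le> card S" for k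
    unfolding f_def using Pj[OF that] by (rule LeastI)
  have Hf: "H (f k) = H i - int k" if k: "k \<le> card S" for k
  proof (rule ccontr)
    assume neq: "H (f k) \<noteq> H i - int k"
    then have less: "H (f k) < H i - int k" using Pf[OF k] by (simp add: P_def)
    then have "f k \<noteq> i" by auto
    \<comment> \<open>Steps change the height by at most one, so overshooting depth \<open>k\<close>
      at time \<open>f k\<close> means that depth \<open>k\<close> was reached at time
      \<open>t\<close> already.\<close>
    then obtain t where t: "f k = Suc t" "i \<le> t"
      using Pf[OF k] unfolding P_def by (metis le_neq_implies_less less_imp_Suc_add le_add1)
    then have "P k t" using less step[of t] by (auto simp: P_def)
    then have "f k \<le> t" unfolding f_def by (rule Least_le)
    then show False using t by simp
  qed
  have f_mono: "f k < f k'" if "k < k'" "k' \<le> card S" for k k'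
  proof -
    have "P k (f k')" using Pf[OF that(2)] that(1) by (auto simp: P_def)
    then have "f k \<le> f k'" unfolding f_def[of k] by (rule Least_le)
    moreover have "f k \<noteq> f k'" using Hf[of k] Hf[of k'] that by auto
    ultimately show ?thesis by simp
  qed
  have "inj_on (\<lambda>k. s (f k)) {..card S}"
  proof (rule linorder_inj_onI)
    fix k k' assume "k < k'" "k \<in> {..card S}" "k' \<in> {..card S}"
    then show "s (f k) \<noteq> s (f k')"
      using f_mono[of k k'] mono[of "f k" "f k'"] Hf[of k] Hf[of k'] by auto
  qed auto
  then have "card {..card S} \<le> card S"
    using S by (intro card_inj_on_le) auto
  then show False by simp
qed

text \<open>Here \<open>y i l\<close> is the entry at absolute level \<open>l\<close> of the tuple visited at time \<open>i\<close>, whose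
  entries occupy the levels \<open>H i + 1, \<dots>, H i + r\<close>. The entry at level \<open>r + inf {H j | j \<ge> i}\<close>
  stays in the window from time \<open>i\<close> to time \<open>i + 1\<close>, so it increases with \<open>i\<close>; over one
  period it increases strictly, although the tuple returns to its old value.\<close>
lemma no_rising_periodic_walk:
  fixes H :: "nat \<Rightarrow> int" and s :: "nat \<Rightarrow> 's" and y :: "nat \<Rightarrow> int \<Rightarrow> int"
  assumes S: "finite S" "\<And>i. s i \<in> S" and r: "int (card S) + 1 \<le> r"
    and step: "\<And>i. \<bar>H (Suc i) - H i\<bar> \<le> 1"
    and mono: "\<And>i j. i < j \<Longrightarrow> s i = s j \<Longrightarrow> H i < H j"
    and period: "\<And>i. H (i + n) = H i + W" "\<And>i l. y (i + n) (l + W) = y i l" and W: "W > 0"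
    and y_mono: "\<And>i l l'. H i < l \<Longrightarrow> l < l' \<Longrightarrow> l' \<le> H i + r \<Longrightarrow> y i l < y i l'"
    and y_step: "\<And>i l. H i < l \<Longrightarrow> l \<le> H i + r \<Longrightarrow> H (Suc i) < l \<Longrightarrow> l \<le> H (Suc i) + r \<Longrightarrow>
        y (Suc i) l = y i l"
  shows False
proof -
  define m where "m i = Inf (H ` {i..})" for i
  \<comment> \<open>The infimum on \<open>int\<close> is only conditional, so a lower bound has to
    be supplied.\<close>
  have bdd: "bdd_below (H ` {i..})" for i
  proof (rule bdd_belowI[where m = "H i - int (card S)"])
    fix x assume "x \<in> H ` {i..}"
    then show "H i - int (card S) \<le> x"
      using drop_less_card[of S s H i] S step mono by fastforce
  qed
  have m_le: "m i \<le> H j" if "i \<le> j" for i j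
    unfolding m_def using that by (intro cInf_lower bdd) simp
  have m_ge: "H i - int (card S) + 1 \<le> m i" for i
    unfolding m_def
  proof (rule cInf_greatest)
    fix x assume "x \<in> H ` {i..}"
    then show "H i - int (card S) + 1 \<le> x"
      using drop_less_card[of S s H i] S step mono by fastforce
  qed simp
  have m_mono: "m i \<le> m (Suc i)" for i
    unfolding m_def by (rule cInf_superset_mono) (auto intro: bdd)
  have "m 0 + W \<le> m n"
    unfolding m_def[of n]
  proof (rule cInf_greatest)
    fix x assume "x \<in> H ` {n..}"
    then obtain j where j: "x = H (j + n)"
      by (metis add.commute atLeast_iff image_iff le_iff_add)
    then show "m 0 + W \<le> x" using period m_le[of 0 j] by simp
  qed simp
  moreover have "m n \<le> m 0 + W"
  proof -
    have "m n - W \<le> m 0"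
      unfolding m_def[of 0]
    proof (rule cInf_greatest)
      fix x assume "x \<in> H ` {0..}"
      then obtain j where "x = H j" by blast
      then show "m n - W \<le> x" using period m_le[of n "j + n"] by simp
    qed simp
    then show ?thesis by simp
  qed
  ultimately have m_n: "m n = m 0 + W" by simp
  define v where "v i = y i (m i + r)" for i
  have v_step: "v i \<le> v (Suc i) \<and> (m i < m (Suc i) \<longrightarrow> v i < v (Suc i))" for i
  proof -
    \<comment> \<open>Here the width of the window matters:
      \<open>H (Suc i) \<le> H i + 1 \<le> m i + card S < m i + r\<close>.\<close>
    have 1: "H i < m i + r" "m i + r \<le> H i + r" "H (Suc i) < m i + r" "m (Suc i) + r \<le> H (Suc i) + r"
      using m_ge[of i] m_le[of i i] m_le[of "Suc i" "Suc i"] step[of i] r by linarith+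
    then have "v i = y (Suc i) (m i + r)"
      using y_step[of i "m i + r"] m_mono[of i] by (simp add: v_def)
    then show ?thesis
      using y_mono[of "Suc i" "m i + r" "m (Suc i) + r"] 1 m_mono[of i] unfolding v_def
      by (cases "m i = m (Suc i)") auto
  qed
  have "m 0 \<le> m k \<and> v 0 \<le> v k \<and> (m 0 < m k \<longrightarrow> v 0 < v k)" for k
  proof (induction k)
    case (Suc k)
    then show ?case using v_step[of k] m_mono[of k] by linarith
  qed simp
  then have "v 0 < v n" using m_n W by simp
  moreover have "v n = v 0"
    using period(2)[of 0 "m 0 + r"] m_n by (simp add: v_def algebra_simps)
  ultimately show False by simp
qed

text \<open>A bad cycle is repeated periodically. Its total weight \<open>W\<close> is nonzero and
  every closed subwalk of states has the sign of \<open>W\<close>, so the walk rises if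
  \<open>W > 0\<close>, and its mirror image rises if \<open>W < 0\<close>;
  \<open>no_rising_periodic_walk\<close> excludes both.\<close>

lemma good_shift_graph:
  assumes M: "two_machine M" and nz: "\<not> zero_cycle (state_edge M)"
    and r: "card (states M) + 1 \<le> r" "2 \<le> r"
  shows "good M (shift_graph r)"
proof (rule ccontr)
  assume "\<not> ?thesis"
  then obtain n v s \<tau> where n: "0 < n" "v n = v 0" "s n = s 0"
    and run: "traced_run M (shift_graph r) n v s \<tau>"
    using not_good_iff_traced_run[OF pair_loopfree_shift_graph[OF r(2)]] by blast
  define s' v' where "s' i = s (i mod n)" and "v' i = v (i mod n)" for i
  define H where "H i = (\<Sum>k<i. trace_weight (\<tau> (k mod n)))" for i
  define W where "W = H n"
  have s'_Suc: "s' (Suc i) = s (Suc (i mod n))" and v'_Suc: "v' (Suc i) = v (Suc (i mod n))" for i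
    using n by (auto simp: s'_def v'_def mod_Suc)
  have H_Suc: "H (Suc i) - H i = trace_weight (\<tau> (i mod n))" for i
    by (simp add: H_def)
  have arcs: "\<exists>e \<in> parcs (shift_graph r). coord e (fst (\<tau> (i mod n))) = v' i \<and>
      coord e (snd (\<tau> (i mod n))) = v' (Suc i)"
    and \<tau>: "\<tau> (i mod n) \<in> {1, 2} \<times> {1, 2}"
    and tr: "s' (Suc i) \<in> trans M (s' i) (\<tau> (i mod n))" for i
    using run mod_less_divisor[OF n(1), of i]
    unfolding traced_run_def v'_Suc s'_Suc v'_def[of i] s'_def[of i] by blast+
  have s'_in: "s' i \<in> states M" for i
    using run n unfolding traced_run_def s'_def by (simp add: less_imp_le)
  have edge: "state_edge M (s' i) (H (Suc i) - H i) (s' (Suc i))" for i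
    unfolding state_edge_def H_Suc using s'_in \<tau> tr by blast
  have step: "\<bar>H (Suc i) - H i\<bar> \<le> 1" for i
    using state_edge_weight[OF edge[of i]] by auto
  have per: "s' (i + n) = s' i" "v' (i + n) = v' i" "H (i + n) = H i + W" for i
  proof -
    show "H (i + n) = H i + W"
    proof (induction i)
      case (Suc i)
      then show ?case by (simp add: H_def)
    qed (simp add: W_def H_def)
  qed (simp_all add: s'_def v'_def)
  have wlk: "walk (state_edge M) (s' i) (H j - H i) (s' j)" if "i \<le> j" for i j
    using edge that by (intro walk_segment) auto
  have "W \<noteq> 0"
  proof
    assume "W = 0"
    then have "zero_cycle (state_edge M)"
      using per(1,3)[of 0] n edge by (intro zero_cycle_of_segment[of 0 n _ s' H]) auto
    then show False using nz by contradiction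
  qed
  \<comment> \<open>A closed subwalk of the wrong sign, combined with one full period from the same
    state, would give a closed walk of weight \<open>0\<close>.\<close>
  have sign: "(W > 0 \<longrightarrow> H i < H j) \<and> (W < 0 \<longrightarrow> H j < H i)" if "i < j" "s' i = s' j" for i j
  proof (rule ccontr)
    assume not: "\<not> ?thesis"
    have full: "walk (state_edge M) (s' i) W (s' i)"
      using wlk[of i "i + n"] per by simp
    have part: "walk (state_edge M) (s' i) (H j - H i) (s' i)"
      using wlk[of i j] that by simp
    have rest1: "walk (state_edge M) (s' (Suc i)) (H j - H i - (H (Suc i) - H i)) (s' i)"
      using wlk[of "Suc i" j] that by simp
    have rest2: "walk (state_edge M) (s' (Suc i)) (W - (H (Suc i) - H i)) (s' i)"
      using wlk[of "Suc i" "i + n"] per n by (simp add: algebra_simps)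
    have "H i \<noteq> H j"
      using zero_cycle_of_segment[of i j "state_edge M" s' H] edge that nz by blast
    then consider "W > 0" "H j - H i \<le> 0" | "W < 0" "H j - H i > 0"
      using not by force
    then show False
    proof cases
      case 1
      then show ?thesis
        using zero_cycle_of_opposite_signs[OF full part _ _ edge rest1] nz by blast
    next
      case 2
      then show ?thesis
        using zero_cycle_of_opposite_signs[OF part full _ _ edge rest2] nz by simp
    qed
  qed
  \<comment> \<open>Entries are addressed by absolute level, index \<open>0\<close> of the list
    being level \<open>H i + 1\<close>. A step along an arc then moves the window by one level and
    leaves the entries common to both windows in place.\<close>
  define y where "y i l = int (v' i ! nat (l - H i - 1))" for i l
  have v'_sorted: "length (v' i) = r \<and> sorted_wrt (<) (v' i)" for i
    using arcs[of i] by (auto simp: shift_graph_def coord_def split: if_splits)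
  have y_mono: "y i l < y i l'" if "H i < l" "l < l'" "l' \<le> H i + int r" for i l l'
  proof -
    have "v' i ! nat (l - H i - 1) < v' i ! nat (l' - H i - 1)"
      using that v'_sorted[of i] by (intro sorted_wrt_nth_less[of "(<)"]) auto
    then show ?thesis by (simp add: y_def)
  qed
  have y_step: "y (Suc i) l = y i l"
    if l: "H i < l" "l \<le> H i + int r" "H (Suc i) < l" "l \<le> H (Suc i) + int r" for i l
  proof -
    obtain e where e: "e \<in> parcs (shift_graph r)" "coord e (fst (\<tau> (i mod n))) = v' i"
      "coord e (snd (\<tau> (i mod n))) = v' (Suc i)"
      using arcs by blast
    have sh: "fst e ! Suc k = snd e ! k" if "Suc k < r" for k
      using e(1) that by (auto simp: shift_graph_def)
    consider "fst (\<tau> (i mod n)) = snd (\<tau> (i mod n))"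
      | "\<tau> (i mod n) = (1, 2)" | "\<tau> (i mod n) = (2, 1)"
      using \<tau>[of i] by force
    then show ?thesis
    proof cases
      case 1
      then have "H (Suc i) = H i" "v' (Suc i) = v' i"
        using H_Suc[of i] e by (auto simp: trace_weight_def)
      then show ?thesis by (simp add: y_def)
    next
      case 2
      then have H: "H (Suc i) = H i + 1" and v: "fst e = v' i" "snd e = v' (Suc i)"
        using H_Suc[of i] e by (auto simp: trace_weight_def coord_def)
      have "nat (l - H i - 1) = Suc (nat (l - H (Suc i) - 1))" using l H by simp
      then show ?thesis
        using sh[of "nat (l - H (Suc i) - 1)"] v l H unfolding y_def by simp
    next
      case 3
      then have H: "H i = H (Suc i) + 1" and v: "snd e = v' i" "fst e = v' (Suc i)"
        using H_Suc[of i] e by (auto simp: trace_weight_def coord_def)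
      have "nat (l - H (Suc i) - 1) = Suc (nat (l - H i - 1))" using l H by simp
      then show ?thesis
        using sh[of "nat (l - H i - 1)"] v l H unfolding y_def by simp
    qed
  qed
  have y_per: "y (i + n) (l + W) = y i l" for i l
    by (simp add: y_def per)
  have fin: "finite (states M)" using M by (simp add: two_machine_def)
  consider "W > 0" | "W < 0" using \<open>W \<noteq> 0\<close> by linarith
  then show False
  proof cases
    case 1
    show ?thesis
    proof (rule no_rising_periodic_walk[OF fin, of s' "int r" H n W y])
      show "int (card (states M)) + 1 \<le> int r" using r by simp
      show "H i < H j" if "i < j" "s' i = s' j" for i j using sign[OF that] 1 by simp
    qed (use s'_in step per(3) y_per 1 y_mono y_step in blast)+
  next
    case 2
    \<comment> \<open>Mirror image: heights and entries are negated and level \<open>l\<close> is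
      exchanged with \<open>r + 1 - l\<close>, which maps windows to windows and keeps the tuples
      increasing.\<close>
    let ?y = "\<lambda>i l. - y i (int r + 1 - l)"
    show ?thesis
    proof (rule no_rising_periodic_walk[OF fin, of s' "int r" "\<lambda>i. - H i" n "- W" ?y])
      show "int (card (states M)) + 1 \<le> int r" using r by simp
      show "- H i < - H j" if "i < j" "s' i = s' j" for i j using sign[OF that] 2 by simp
      show "?y (i + n) (l + - W) = ?y i l" for i l
        using y_per[of i "int r + 1 - l"] by (simp add: algebra_simps)
      show "?y i l < ?y i l'" if "- H i < l" "l < l'" "l' \<le> - H i + int r" for i l l'
        using y_mono[of i "int r + 1 - l'" "int r + 1 - l"] that by simp
      show "?y (Suc i) l = ?y i l"
        if "- H i < l" "l \<le> - H i + int r" "- H (Suc i) < l" "l \<le> - H (Suc i) + int r" for i l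
        using y_step[of i "int r + 1 - l"] that by simp
      show "\<bar>- H (Suc i) - - H i\<bar> \<le> 1" for i using step[of i] by simp
    qed (use s'_in per(3) 2 in auto)
  qed
qed

text \<open>A shift graph is copied into the type \<open>'v\<close> by an injection \<open>g\<close>
  of the countable type of tuples. The copy is good since \<open>inv g\<close> is a homomorphism
  back, and a colouring of it would colour the shift graph by composition with
  \<open>g\<close>.\<close>

lemma good_digraph_with_infinite_chromatic_number:
  assumes "infinite (UNIV :: 'v set)" and M: "two_machine M" and nz: "\<not> zero_cycle (state_edge M)"
  shows "\<exists>G :: 'v pair_pre_digraph. pair_loopfree_digraph G \<and> good M G \<and> chromatic_number G = \<infinity>"
proof -
  obtain f :: "nat \<Rightarrow> 'v" where f: "inj f"
    using assms(1) unfolding infinite_iff_countable_subset by blast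
  define g :: "nat list \<Rightarrow> 'v" where "g = f \<circ> to_nat"
  have g: "inj g" unfolding g_def using f by (intro inj_compose) auto
  define r where "r = card (states M) + 2"
  let ?S = "shift_graph r"
  define G where "G = \<lparr>pverts = g ` pverts ?S, parcs = map_prod g g ` parcs ?S\<rparr>"
  interpret S: pair_loopfree_digraph ?S
    by (rule pair_loopfree_shift_graph) (simp add: r_def)
  have G_arcs: "(a, b) \<in> parcs G \<longleftrightarrow> (\<exists>xs ys. a = g xs \<and> b = g ys \<and> (xs, ys) \<in> parcs ?S)" for a b
    by (auto simp: G_def)
  have G: "pair_loopfree_digraph G"
  proof
    fix e assume "e \<in> parcs G"
    then obtain xs ys where e: "e = (g xs, g ys)" "(xs, ys) \<in> parcs ?S"
      using G_arcs[of "fst e" "snd e"] by (metis prod.collapse)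
    show "fst e \<in> pverts G" using S.arc_fst_in_verts[OF e(2)] e(1) by (simp add: G_def)
    show "snd e \<in> pverts G" using S.arc_snd_in_verts[OF e(2)] e(1) by (simp add: G_def)
    show "fst e \<noteq> snd e" using S.pair_no_loops[OF e(2)] e(1) g by (simp add: inj_eq)
  qed
  have "good M G"
  proof (rule good_homomorphism[OF G S.pair_loopfree_digraph_axioms, where h = "inv g"])
    show "good M ?S" by (rule good_shift_graph[OF M nz]) (simp_all add: r_def)
    show "(inv g a, inv g b) \<in> parcs ?S" if "(a, b) \<in> parcs G" for a b
      using that g unfolding G_arcs by auto
  qed
  moreover have "\<not> (\<exists>c \<in> pverts G \<rightarrow> {1..k}. \<forall>(a, b) \<in> parcs G. c a \<noteq> c b)" for k :: nat
  proof
    assume "\<exists>c \<in> pverts G \<rightarrow> {1..k}. \<forall>(a, b) \<in> parcs G. c a \<noteq> c b"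
    then obtain c where c: "c \<in> pverts G \<rightarrow> {1..k}" "\<And>a b. (a, b) \<in> parcs G \<Longrightarrow> c a \<noteq> c b"
      by blast
    have "c \<circ> g \<in> pverts ?S \<rightarrow> {1..k}"
      using c(1) by (simp add: G_def Pi_iff)
    from shift_graph_not_colourable[OF this]
    obtain xs ys where "(xs, ys) \<in> parcs ?S" "c (g xs) = c (g ys)"
      by auto
    then show False
      using c(2)[of "g xs" "g ys"] unfolding G_arcs by blast
  qed
  then have "chromatic_number G = \<infinity>"
    unfolding chromatic_number_def by (simp add: Inf_enat_def top_enat_def)
  ultimately show ?thesis using G by blast
qed

lemma large_chromatic_number_iff:
  assumes "infinite (UNIV :: 'v set)" "two_machine M"
  shows "(\<forall>k :: nat. \<exists>G :: 'v pair_pre_digraph.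
      pair_loopfree_digraph G \<and> good M G \<and> chromatic_number G \<ge> enat k) \<longleftrightarrow>
    (\<forall>n \<ge> 1. good M (dipath n))"
proof (intro iffI allI impI)
  fix n assume large: "\<forall>k :: nat. \<exists>G :: 'v pair_pre_digraph.
      pair_loopfree_digraph G \<and> good M G \<and> chromatic_number G \<ge> enat k"
  show "good M (dipath n)"
  proof (rule ccontr)
    assume bad: "\<not> good M (dipath n)"
    obtain G :: "'v pair_pre_digraph" where G: "pair_loopfree_digraph G" "good M G"
      "chromatic_number G \<ge> enat (Suc n)"
      using large by blast
    have "enat (Suc n) \<le> enat n"
      using order_trans[OF G(3) chromatic_number_le_of_good[OF G(1,2) bad]] .
    then show False by simp
  qed
next
  fix k :: nat assume "\<forall>n \<ge> 1. good M (dipath n)"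
  then show "\<exists>G :: 'v pair_pre_digraph.
      pair_loopfree_digraph G \<and> good M G \<and> chromatic_number G \<ge> enat k"
    using good_digraph_with_infinite_chromatic_number[OF assms] all_dipaths_good_iff
    by (metis enat_ord_code(3))
qed

section \<open>A small loop language on the random access machine\<close>

text \<open>Register \<open>0\<close> holds \<open>0\<close>, register \<open>1\<close> the number of states and register \<open>2\<close> the number
  \<open>1\<close>. Variables are the registers below \<open>16\<close>, temporaries the registers from \<open>16\<close> to \<open>31\<close>, and
  the table occupies the registers from \<open>32\<close> onwards. The semantics ignores the temporaries.\<close>

datatype expr =
    Num nat
  | Var nat
  | Plus expr expr
  | TimesN expr
  | Input expr
  | Table expr
  | And expr expr

text \<open>There is neither a conditional command nor an unbounded loop: branching is confined to
  \<open>And\<close>, and each \<open>For\<close> runs \<open>m 1\<close> rounds. Hence the running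
  time is bounded by a polynomial defined by recursion on the command.\<close>

datatype cmd =
    Assign nat expr
  | Put expr expr
  | Seq cmd cmd
  | For nat cmd

primrec eval :: "bool list \<Rightarrow> expr \<Rightarrow> (nat \<Rightarrow> nat) \<Rightarrow> nat" where
  "eval w (Num c) m = c"
| "eval w (Var x) m = m x"
| "eval w (Plus a b) m = eval w a m + eval w b m"
| "eval w (TimesN a) m = eval w a m * m 1"
| "eval w (Input a) m = input_symbol w (eval w a m)"
| "eval w (Table a) m = m (32 + eval w a m)"
| "eval w (And a b) m = (if eval w a m = 0 then 0 else eval w b m)"

text \<open>\<open>For\<close> counts down and leaves \<open>0\<close> in its variable, because the
  compiled loop uses that register itself as the counter and stops when it is zero.\<close>

primrec sem :: "bool list \<Rightarrow> cmd \<Rightarrow> (nat \<Rightarrow> nat) \<Rightarrow> nat \<Rightarrow> nat" where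
  "sem w (Assign x e) m = m(x := eval w e m)"
| "sem w (Put a b) m = m(32 + eval w a m := eval w b m)"
| "sem w (Seq c d) m = sem w d (sem w c m)"
| "sem w (For x c) m = (fold (\<lambda>i \<mu>. sem w c (\<mu>(x := i))) (rev [0..<m 1]) m)(x := 0)"

text \<open>Bounds the number of consecutive registers, from the target upwards, that the compiled
  expression may overwrite.\<close>

primrec temporaries :: "expr \<Rightarrow> nat" where
  "temporaries (Num c) = 1"
| "temporaries (Var x) = 1"
| "temporaries (Plus a b) = max (temporaries a) (Suc (temporaries b))"
| "temporaries (TimesN a) = max 3 (Suc (temporaries a))"
| "temporaries (Input a) = temporaries a"
| "temporaries (Table a) = max 2 (temporaries a)"
| "temporaries (And a b) = max (temporaries a) (temporaries b)"

primrec wf_expr :: "expr \<Rightarrow> bool" where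
  "wf_expr (Num c) \<longleftrightarrow> True"
| "wf_expr (Var x) \<longleftrightarrow> x < 16"
| "wf_expr (Plus a b) \<longleftrightarrow> wf_expr a \<and> wf_expr b"
| "wf_expr (TimesN a) \<longleftrightarrow> wf_expr a"
| "wf_expr (Input a) \<longleftrightarrow> wf_expr a"
| "wf_expr (Table a) \<longleftrightarrow> wf_expr a"
| "wf_expr (And a b) \<longleftrightarrow> wf_expr a \<and> wf_expr b"

primrec assigned :: "cmd \<Rightarrow> nat set" where
  "assigned (Assign x e) = {x}"
| "assigned (Put a b) = {}"
| "assigned (Seq c d) = assigned c \<union> assigned d"
| "assigned (For x c) = insert x (assigned c)"

text \<open>Assigned variables start at \<open>3\<close> to protect the constants in registers
  \<open>0\<close> to \<open>2\<close>. \<open>Put\<close> keeps its address in register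
  \<open>16\<close> while \<open>b\<close> is evaluated from register \<open>17\<close> on, hence
  the bound \<open>15\<close>.\<close>

primrec wf_cmd :: "cmd \<Rightarrow> bool" where
  "wf_cmd (Assign x e) \<longleftrightarrow> x \<in> {3..<16} \<and> wf_expr e \<and> temporaries e \<le> 16"
| "wf_cmd (Put a b) \<longleftrightarrow> wf_expr a \<and> wf_expr b \<and> temporaries a \<le> 16 \<and> temporaries b \<le> 15"
| "wf_cmd (Seq c d) \<longleftrightarrow> wf_cmd c \<and> wf_cmd d"
| "wf_cmd (For x c) \<longleftrightarrow> x \<in> {3..<16} \<and> x \<notin> assigned c \<and> wf_cmd c"

text \<open>The arguments are the target register and the address of the first instruction.\<close>
primrec compile_expr :: "expr \<Rightarrow> nat \<Rightarrow> nat \<Rightarrow> instr list" where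
  "compile_expr (Num c) d p = [Const d c]"
| "compile_expr (Var x) d p = [Add d x 0]"
| "compile_expr (Plus a b) d p =
     (let ca = compile_expr a d p; cb = compile_expr b (Suc d) (p + length ca)
      in ca @ cb @ [Add d d (Suc d)])"
| "compile_expr (TimesN a) d p =
     (let ca = compile_expr a (Suc d) p; q = p + length ca
      in ca @ [Add (d + 2) 1 0, Const d 0, JumpZero (d + 2) (q + 6), Sub (d + 2) (d + 2) 2,
           Add d d (Suc d), JumpZero 0 (q + 2)])"
| "compile_expr (Input a) d p = compile_expr a d p @ [Read d d]"
| "compile_expr (Table a) d p = compile_expr a d p @ [Const (Suc d) 32, Add d d (Suc d), Load d d]"
| "compile_expr (And a b) d p =
     (let ca = compile_expr a d p; cb = compile_expr b d (p + length ca + 1)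
      in ca @ [JumpZero d (p + length ca + 1 + length cb)] @ cb)"

text \<open>\<open>JumpZero 0\<close> is an unconditional jump since register \<open>0\<close> holds
  \<open>0\<close>. Jump targets are absolute; \<open>p + 4 + length cc\<close> is the first address
  after the loop.\<close>

primrec compile :: "cmd \<Rightarrow> nat \<Rightarrow> instr list" where
  "compile (Assign x e) p = compile_expr e 16 p @ [Add x 16 0]"
| "compile (Put a b) p =
     (let ca = compile_expr a 16 p
      in ca @ [Const 17 32, Add 16 16 17] @ compile_expr b 17 (p + length ca + 2) @ [Store 16 17])"
| "compile (Seq c d) p = (let cc = compile c p in cc @ compile d (p + length cc))"
| "compile (For x c) p =
     (let cc = compile c (p + 3)
      in [Add x 1 0, JumpZero x (p + 4 + length cc), Sub x x 2] @ cc @ [JumpZero 0 (p + 1)])"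

text \<open>A polynomial in the number of states. Multiplication is repeated addition: two
  instructions of setup, four per round and one to leave. For \<open>And\<close> both parts are
  charged.\<close>

primrec expr_cost :: "expr \<Rightarrow> nat poly" where
  "expr_cost (Num c) = 1"
| "expr_cost (Var x) = 1"
| "expr_cost (Plus a b) = expr_cost a + expr_cost b + 1"
| "expr_cost (TimesN a) = expr_cost a + [:3, 4:]"
| "expr_cost (Input a) = expr_cost a + 1"
| "expr_cost (Table a) = expr_cost a + 3"
| "expr_cost (And a b) = expr_cost a + expr_cost b + 1"

primrec cost :: "cmd \<Rightarrow> nat poly" where
  "cost (Assign x e) = expr_cost e + 1"
| "cost (Put a b) = expr_cost a + expr_cost b + 3"
| "cost (Seq c d) = cost c + cost d"
| "cost (For x c) = [:0, 1:] * (cost c + 3) + 2"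

section \<open>Correctness and running time of compiled code\<close>

primrec code_at :: "instr list \<Rightarrow> nat \<Rightarrow> instr list \<Rightarrow> bool" where
  "code_at P p [] \<longleftrightarrow> True"
| "code_at P p (i # cs) \<longleftrightarrow> p < length P \<and> P ! p = i \<and> code_at P (Suc p) cs"

lemma code_at_append:
  "code_at P p (as @ bs) \<longleftrightarrow> code_at P p as \<and> code_at P (p + length as) bs"
  by (induction as arbitrary: p) auto

lemma code_at_middle: "code_at (xs @ cs @ ys) (length xs) cs"
proof (induction cs arbitrary: xs)
  case (Cons i cs)
  then show ?case using Cons[of "xs @ [i]"] by (simp add: nth_append)
qed simp

definition reaches :: "instr list \<Rightarrow> bool list \<Rightarrow> nat \<Rightarrow> config \<Rightarrow> config \<Rightarrow> bool" where
  "reaches P w t cf cf' \<longleftrightarrow> (\<exists>k \<le> t. (step P w ^^ k) cf = cf')"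

lemma reaches_trans:
  assumes "reaches P w t a b" "reaches P w t' b c"
  shows "reaches P w (t + t') a c"
proof -
  obtain k k' where "k \<le> t" "(step P w ^^ k) a = b" "k' \<le> t'" "(step P w ^^ k') b = c"
    using assms unfolding reaches_def by blast
  then show ?thesis
    unfolding reaches_def by (intro exI[of _ "k' + k"]) (simp add: funpow_add)
qed

lemma reaches_mono: "reaches P w t a b \<Longrightarrow> t \<le> t' \<Longrightarrow> reaches P w t' a b"
  unfolding reaches_def using le_trans by blast

lemma reaches_instr:
  assumes "p < length P" "P ! p = i" "exec w i (p, m) = cf"
  shows "reaches P w 1 (p, m) cf"
  unfolding reaches_def using assms by (intro exI[of _ 1]) (simp add: step_def)

lemma reaches_snoc:
  assumes "reaches P w t cf (p, m)" "p < length P" "P ! p = i"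
  shows "reaches P w (t + 1) cf (exec w i (p, m))"
  using reaches_trans[OF assms(1) reaches_instr[OF assms(2,3) refl]] .

lemma temporaries_pos: "0 < temporaries e"
  by (induction e) auto

lemma eval_cong:
  assumes "wf_expr e" "\<And>r. r < 16 \<or> 32 \<le> r \<Longrightarrow> m r = m' r"
  shows "eval w e m = eval w e m'"
  using assms by (induction e) auto

text \<open>Preserving all registers below the target keeps variables and intermediate results
  intact, and \<open>d + temporaries e \<le> 32\<close> keeps the temporaries clear of the table;
  both are needed for subexpressions.\<close>

lemma compile_expr_correct:
  assumes "code_at P p (compile_expr e d p)" "wf_expr e" "16 \<le> d" "d + temporaries e \<le> 32"
    "m 0 = 0" "m 2 = 1"
  shows "\<exists>m' :: nat \<Rightarrow> nat. reaches P w (poly (expr_cost e) (m 1)) (p, m) (p + length (compile_expr e d p), m') \<and>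
    m' d = eval w e m \<and> (\<forall>r. r < d \<or> 32 \<le> r \<longrightarrow> m' r = m r)"
  using assms
proof (induction e arbitrary: d p m)
  case (Num c)
  show ?case
  proof (intro exI conjI)
    show "reaches P w (poly (expr_cost (Num c)) (m 1)) (p, m)
        (p + length (compile_expr (Num c) d p), m(d := c))"
      using reaches_instr[of p P "Const d c" w m "(Suc p, m(d := c))"] Num.prems by simp
  qed (use Num.prems in auto)
next
  case (Var x)
  show ?case
  proof (intro exI conjI)
    show "reaches P w (poly (expr_cost (Var x)) (m 1)) (p, m)
        (p + length (compile_expr (Var x) d p), m(d := m x))"
      using reaches_instr[of p P "Add d x 0" w m "(Suc p, m(d := m x))"] Var.prems by simp
  qed (use Var.prems in auto)
next
  case (Plus a b)
  define ca where "ca = compile_expr a d p"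
  define cb where "cb = compile_expr b (Suc d) (p + length ca)"
  have code: "code_at P p ca" "code_at P (p + length ca) cb"
    "p + length ca + length cb < length P" "P ! (p + length ca + length cb) = Add d d (Suc d)"
    using Plus.prems(1) by (simp_all add: Let_def code_at_append ca_def cb_def)
  obtain m1 where m1: "reaches P w (poly (expr_cost a) (m 1)) (p, m) (p + length ca, m1)"
    "m1 d = eval w a m" "\<forall>r. r < d \<or> 32 \<le> r \<longrightarrow> m1 r = m r"
    using Plus.IH(1)[of p d m] Plus.prems code unfolding ca_def by (auto simp: nat_add_max_right)
  have reg: "m1 0 = 0" "m1 1 = m 1" "m1 2 = 1"
    using m1(3) Plus.prems by auto
  obtain m2 where m2: "reaches P w (poly (expr_cost b) (m 1)) (p + length ca, m1)
      (p + length ca + length cb, m2)"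
    "m2 (Suc d) = eval w b m1" "\<forall>r. r < Suc d \<or> 32 \<le> r \<longrightarrow> m2 r = m1 r"
    using Plus.IH(2)[of "p + length ca" "Suc d" m1] Plus.prems code reg unfolding cb_def
    by (auto simp: nat_add_max_right)
  have "eval w b m1 = eval w b m"
    using m1(3) Plus.prems by (intro eval_cong) auto
  moreover have "reaches P w (poly (expr_cost (Plus a b)) (m 1)) (p, m)
      (p + length (compile_expr (Plus a b) d p), m2(d := m2 d + m2 (Suc d)))"
    using reaches_snoc[OF reaches_trans[OF m1(1) m2(1)] code(3,4)]
    by (simp add: Let_def ca_def[symmetric] cb_def[symmetric] add.assoc)
  ultimately show ?case
    using m1 m2 Plus.prems(4) by (intro exI conjI) (assumption, auto)
next
  case (TimesN a)
  define ca where "ca = compile_expr a (Suc d) p"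
  define q where "q = p + length ca"
  have code: "code_at P p ca"
    "code_at P q [Add (d + 2) 1 0, Const d 0, JumpZero (d + 2) (q + 6), Sub (d + 2) (d + 2) 2,
           Add d d (Suc d), JumpZero 0 (q + 2)]"
    using TimesN.prems(1) by (simp_all add: Let_def code_at_append ca_def q_def)
  have in_code: "q + 5 < length P" "P ! q = Add (d + 2) 1 0" "P ! (q + 1) = Const d 0"
    "P ! (q + 2) = JumpZero (d + 2) (q + 6)" "P ! (q + 3) = Sub (d + 2) (d + 2) 2"
    "P ! (q + 4) = Add d d (Suc d)" "P ! (q + 5) = JumpZero 0 (q + 2)"
    using code(2) by (simp_all add: numeral_eq_Suc)
  obtain m1 where m1: "reaches P w (poly (expr_cost a) (m 1)) (p, m) (q, m1)"
    "m1 (Suc d) = eval w a m" "\<forall>r. r < Suc d \<or> 32 \<le> r \<longrightarrow> m1 r = m r"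
    using TimesN.IH[of p "Suc d" m] TimesN.prems code(1) unfolding ca_def q_def
    by (auto simp: nat_add_max_right)
  \<comment> \<open>Register \<open>d + 2\<close> counts the remaining rounds and \<open>d\<close>
    accumulates copies of the factor in \<open>Suc d\<close>.\<close>
  have loop: "\<exists>m' :: nat \<Rightarrow> nat. reaches P w (4 * k + 1) (q + 2, \<mu>) (q + 6, m') \<and>
      m' d = \<mu> d + \<mu> (Suc d) * k \<and> (\<forall>r. r < d \<or> 32 \<le> r \<longrightarrow> m' r = \<mu> r)"
    if "\<mu> (d + 2) = k" "\<mu> 0 = 0" "\<mu> 2 = 1" for k \<mu>
    using that
  proof (induction k arbitrary: \<mu>)
    case 0
    then show ?case
      using reaches_instr[of "q + 2" P "JumpZero (d + 2) (q + 6)" w \<mu> "(q + 6, \<mu>)"] in_code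
      by (intro exI[of _ \<mu>]) auto
  next
    case (Suc k)
    define \<mu>' where "\<mu>' = \<mu>(d + 2 := k, d := \<mu> d + \<mu> (Suc d))"
    have round: "reaches P w (1 + 1 + 1 + 1) (q + 2, \<mu>) (q + 2, \<mu>')"
    proof (rule reaches_trans[OF reaches_trans[OF reaches_trans]])
      show "reaches P w 1 (q + 2, \<mu>) (q + 3, \<mu>)"
        using in_code Suc.prems by (intro reaches_instr[where i = "JumpZero (d + 2) (q + 6)"]) auto
      show "reaches P w 1 (q + 3, \<mu>) (q + 4, \<mu>(d + 2 := k))"
        using in_code Suc.prems by (intro reaches_instr[where i = "Sub (d + 2) (d + 2) 2"]) auto
      show "reaches P w 1 (q + 4, \<mu>(d + 2 := k)) (q + 5, \<mu>')"
        using in_code by (intro reaches_instr[where i = "Add d d (Suc d)"]) (auto simp: \<mu>'_def)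
      show "reaches P w 1 (q + 5, \<mu>') (q + 2, \<mu>')"
        using in_code Suc.prems TimesN.prems
        by (intro reaches_instr[where i = "JumpZero 0 (q + 2)"]) (auto simp: \<mu>'_def)
    qed
    obtain m' where m': "reaches P w (4 * k + 1) (q + 2, \<mu>') (q + 6, m')"
      "m' d = \<mu>' d + \<mu>' (Suc d) * k" "\<forall>r. r < d \<or> 32 \<le> r \<longrightarrow> m' r = \<mu>' r"
    proof -
      have "\<mu>' (d + 2) = k" "\<mu>' 0 = 0" "\<mu>' 2 = 1"
        using Suc.prems TimesN.prems by (auto simp: \<mu>'_def)
      then show thesis using Suc.IH[of \<mu>'] that by blast
    qed
    have "reaches P w (4 * Suc k + 1) (q + 2, \<mu>) (q + 6, m')"
      by (rule reaches_mono[OF reaches_trans[OF round m'(1)]]) simp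
    then show ?case
      using m'(2,3) TimesN.prems by (intro exI conjI) (assumption, auto simp: \<mu>'_def)
  qed
  define m2 where "m2 = m1(d + 2 := m 1, d := 0)"
  have m2_run: "reaches P w (1 + 1) (q, m1) (q + 2, m2)"
  proof (rule reaches_trans)
    show "reaches P w 1 (q, m1) (q + 1, m1(d + 2 := m 1))"
      using in_code m1(3) TimesN.prems by (intro reaches_instr[where i = "Add (d + 2) 1 0"]) auto
    show "reaches P w 1 (q + 1, m1(d + 2 := m 1)) (q + 2, m2)"
      using in_code by (intro reaches_instr[where i = "Const d 0"]) (auto simp: m2_def)
  qed
  obtain m' where m': "reaches P w (4 * m 1 + 1) (q + 2, m2) (q + 6, m')"
    "m' d = m2 d + m2 (Suc d) * m 1" "\<forall>r. r < d \<or> 32 \<le> r \<longrightarrow> m' r = m2 r"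
  proof -
    have "m2 (d + 2) = m 1" "m2 0 = 0" "m2 2 = 1"
      using m1(3) TimesN.prems by (auto simp: m2_def)
    then show thesis using loop[of m2 "m 1"] that by blast
  qed
  have "p + length (compile_expr (TimesN a) d p) = q + 6"
    by (simp add: Let_def ca_def[symmetric] q_def)
  then have "reaches P w (poly (expr_cost (TimesN a)) (m 1)) (p, m)
      (p + length (compile_expr (TimesN a) d p), m')"
    using reaches_trans[OF m1(1) reaches_trans[OF m2_run m'(1)]]
    by (elim ssubst reaches_mono) simp
  moreover have "m' d = eval w (TimesN a) m" "\<forall>r. r < d \<or> 32 \<le> r \<longrightarrow> m' r = m r"
    using m' m1 TimesN.prems by (auto simp: m2_def)
  ultimately show ?case by blast
next
  case (Input a)
  define ca where "ca = compile_expr a d p"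
  have code: "code_at P p ca" "p + length ca < length P" "P ! (p + length ca) = Read d d"
    using Input.prems(1) by (simp_all add: code_at_append ca_def)
  obtain m1 where m1: "reaches P w (poly (expr_cost a) (m 1)) (p, m) (p + length ca, m1)"
    "m1 d = eval w a m" "\<forall>r. r < d \<or> 32 \<le> r \<longrightarrow> m1 r = m r"
    using Input.IH[of p d m] Input.prems code unfolding ca_def by auto
  have "reaches P w (poly (expr_cost (Input a)) (m 1)) (p, m)
      (p + length (compile_expr (Input a) d p), m1(d := input_symbol w (m1 d)))"
    using reaches_snoc[OF m1(1) code(2,3)] by (simp add: ca_def)
  then show ?case
    using m1 Input.prems(4) temporaries_pos[of a] by (intro exI conjI) (assumption, auto)
next
  case (Table a)
  define ca where "ca = compile_expr a d p"
  define q where "q = p + length ca"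
  have code: "code_at P p ca" "q + 2 < length P"
    "P ! q = Const (Suc d) 32" "P ! (q + 1) = Add d d (Suc d)" "P ! (q + 2) = Load d d"
    using Table.prems(1) by (simp_all add: code_at_append ca_def q_def numeral_eq_Suc)
  obtain m1 where m1: "reaches P w (poly (expr_cost a) (m 1)) (p, m) (q, m1)"
    "m1 d = eval w a m" "\<forall>r. r < d \<or> 32 \<le> r \<longrightarrow> m1 r = m r"
    using Table.IH[of p d m] Table.prems code unfolding ca_def q_def
    by (auto simp: nat_add_max_right)
  let ?a = "32 + eval w a m"
  have "reaches P w (1 + 1 + 1) (q, m1) (q + 3, m1(Suc d := 32, d := m ?a))"
  proof (rule reaches_trans[OF reaches_trans])
    show "reaches P w 1 (q, m1) (q + 1, m1(Suc d := 32))"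
      using code by (intro reaches_instr[where i = "Const (Suc d) 32"]) auto
    show "reaches P w 1 (q + 1, m1(Suc d := 32)) (q + 2, m1(Suc d := 32, d := ?a))"
      using code m1(2)
      by (intro reaches_instr[where i = "Add d d (Suc d)"]) (auto simp: add.commute)
    show "reaches P w 1 (q + 2, m1(Suc d := 32, d := ?a)) (q + 3, m1(Suc d := 32, d := m ?a))"
      using code m1(3) Table.prems
      by (intro reaches_instr[where i = "Load d d"]) (auto simp: fun_upd_def)
  qed
  from reaches_trans[OF m1(1) this]
  have "reaches P w (poly (expr_cost (Table a)) (m 1)) (p, m)
      (p + length (compile_expr (Table a) d p), m1(Suc d := 32, d := m ?a))"
    by (simp add: ca_def[symmetric] q_def add.assoc numeral_eq_Suc)
  then show ?case
    using m1(3) Table.prems by (intro exI conjI) (assumption, auto)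
next
  case (And a b)
  define ca where "ca = compile_expr a d p"
  define cb where "cb = compile_expr b d (p + length ca + 1)"
  define q where "q = p + length ca"
  have code: "code_at P p ca" "q < length P" "P ! q = JumpZero d (q + 1 + length cb)"
    "code_at P (q + 1) cb"
    using And.prems(1) by (simp_all add: Let_def code_at_append ca_def cb_def q_def)
  have len: "p + length (compile_expr (And a b) d p) = q + 1 + length cb"
    by (simp add: Let_def ca_def cb_def q_def)
  obtain m1 where m1: "reaches P w (poly (expr_cost a) (m 1)) (p, m) (q, m1)"
    "m1 d = eval w a m" "\<forall>r. r < d \<or> 32 \<le> r \<longrightarrow> m1 r = m r"
    using And.IH(1)[of p d m] And.prems code unfolding ca_def q_def
    by (auto simp: nat_add_max_right)
  note jump = reaches_snoc[OF m1(1) code(2,3)]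
  show ?case
  proof (cases "eval w a m = 0")
    case True
    then show ?thesis
      using jump m1 unfolding len
      by (intro exI[of _ m1]) (auto elim: reaches_mono)
  next
    case False
    have reg: "m1 0 = 0" "m1 1 = m 1" "m1 2 = 1"
      using m1(3) And.prems by auto
    obtain m2 where m2: "reaches P w (poly (expr_cost b) (m 1)) (q + 1, m1) (q + 1 + length cb, m2)"
      "m2 d = eval w b m1" "\<forall>r. r < d \<or> 32 \<le> r \<longrightarrow> m2 r = m1 r"
      using And.IH(2)[of "q + 1" d m1] And.prems code reg unfolding cb_def q_def
      by (auto simp: nat_add_max_right)
    have "eval w b m1 = eval w b m"
      using m1(3) And.prems by (intro eval_cong) auto
    moreover have "reaches P w (poly (expr_cost a) (m 1) + 1) (p, m) (q + 1, m1)"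
      using jump False m1(2) by simp
    from reaches_trans[OF this m2(1)]
    have "reaches P w (poly (expr_cost (And a b)) (m 1)) (p, m) (q + 1 + length cb, m2)"
      by (simp add: algebra_simps)
    ultimately show ?thesis
      using False m1 m2 unfolding len by (intro exI[of _ m2]) auto
  qed
qed

definition agree :: "(nat \<Rightarrow> nat) \<Rightarrow> (nat \<Rightarrow> nat) \<Rightarrow> bool" where
  "agree m \<mu> \<longleftrightarrow> (\<forall>r. r < 16 \<or> 32 \<le> r \<longrightarrow> m r = \<mu> r)"

lemma sem_unassigned:
  "wf_cmd c \<Longrightarrow> r < 16 \<Longrightarrow> r \<notin> assigned c \<Longrightarrow> sem w c m r = m r"
proof (induction c arbitrary: m)
  case (For x c)
  have "fold (\<lambda>i \<mu>. sem w c (\<mu>(x := i))) is \<mu> r = \<mu> r" for "is" \<mu>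
    using For by (induction "is" arbitrary: \<mu>) auto
  then show ?case using For by auto
qed auto

lemma assigned_ge: "wf_cmd c \<Longrightarrow> r \<in> assigned c \<Longrightarrow> 3 \<le> r"
  by (induction c) auto

lemma sem_constants:
  "wf_cmd c \<Longrightarrow> r < 3 \<Longrightarrow> sem w c m r = m r"
  using assigned_ge[of c r] by (intro sem_unassigned) auto

text \<open>A simulation up to the temporaries. Registers \<open>0\<close> to \<open>2\<close> never
  change, so the jumps, the decrements and the loop bound keep their meaning throughout.\<close>

lemma compile_correct:
  assumes "code_at P p (compile c p)" "wf_cmd c" "agree m \<mu>" "m 0 = 0" "m 2 = 1"
  shows "\<exists>m' :: nat \<Rightarrow> nat. reaches P w (poly (cost c) (m 1)) (p, m) (p + length (compile c p), m') \<and>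
    agree m' (sem w c \<mu>)"
  using assms
proof (induction c arbitrary: p m \<mu>)
  case (Assign x e)
  define ce where "ce = compile_expr e 16 p"
  have code: "code_at P p ce" "p + length ce < length P" "P ! (p + length ce) = Add x 16 0"
    using Assign.prems(1) by (simp_all add: code_at_append ce_def)
  obtain m1 where m1: "reaches P w (poly (expr_cost e) (m 1)) (p, m) (p + length ce, m1)"
    "m1 16 = eval w e m" "\<forall>r. r < 16 \<or> 32 \<le> r \<longrightarrow> m1 r = m r"
    using compile_expr_correct[of P p e 16 m w] Assign.prems code unfolding ce_def by auto
  have "eval w e m = eval w e \<mu>"
    using Assign.prems by (intro eval_cong) (auto simp: agree_def)
  then have "agree (m1(x := m1 16)) (sem w (Assign x e) \<mu>)"
    using m1 Assign.prems by (auto simp: agree_def)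
  moreover have "reaches P w (poly (cost (Assign x e)) (m 1)) (p, m)
      (p + length (compile (Assign x e) p), m1(x := m1 16))"
    using reaches_snoc[OF m1(1) code(2,3)] m1(3) Assign.prems by (simp add: ce_def)
  ultimately show ?case by blast
next
  case (Put a b)
  define ca where "ca = compile_expr a 16 p"
  define q where "q = p + length ca"
  define cb where "cb = compile_expr b 17 (q + 2)"
  have code: "code_at P p ca" "q + 1 < length P" "P ! q = Const 17 32" "P ! (q + 1) = Add 16 16 17"
    "code_at P (q + 2) cb" "q + 2 + length cb < length P" "P ! (q + 2 + length cb) = Store 16 17"
    using Put.prems(1)
    by (simp_all add: Let_def code_at_append ca_def[symmetric] cb_def[symmetric] q_def)
      (simp_all add: cb_def q_def)
  have len: "p + length (compile (Put a b) p) = q + 2 + length cb + 1"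
    by (simp add: Let_def ca_def[symmetric] cb_def q_def)
  obtain m1 where m1: "reaches P w (poly (expr_cost a) (m 1)) (p, m) (q, m1)"
    "m1 16 = eval w a m" "\<forall>r. r < 16 \<or> 32 \<le> r \<longrightarrow> m1 r = m r"
    using compile_expr_correct[of P p a 16 m w] Put.prems code unfolding ca_def q_def by auto
  define m2 where "m2 = m1(17 := 32, 16 := 32 + eval w a m)"
  have run2: "reaches P w (1 + 1) (q, m1) (q + 2, m2)"
  proof (rule reaches_trans)
    show "reaches P w 1 (q, m1) (q + 1, m1(17 := 32))"
      using code by (intro reaches_instr[where i = "Const 17 32"]) auto
    show "reaches P w 1 (q + 1, m1(17 := 32)) (q + 2, m2)"
      using code m1(2)
      by (intro reaches_instr[where i = "Add 16 16 17"]) (auto simp: m2_def add.commute)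
  qed
  have reg: "m2 0 = 0" "m2 1 = m 1" "m2 2 = 1"
    using m1(3) Put.prems by (auto simp: m2_def)
  obtain m3 where m3: "reaches P w (poly (expr_cost b) (m 1)) (q + 2, m2) (q + 2 + length cb, m3)"
    "m3 17 = eval w b m2" "\<forall>r. r < 17 \<or> 32 \<le> r \<longrightarrow> m3 r = m2 r"
    using compile_expr_correct[of P "q + 2" b 17 m2 w] Put.prems code reg unfolding cb_def by auto
  have "reaches P w (poly (cost (Put a b)) (m 1)) (p, m)
      (p + length (compile (Put a b) p), m3(m3 16 := m3 17))"
    using reaches_snoc[OF reaches_trans[OF reaches_trans[OF m1(1) run2] m3(1)] code(6,7)]
    unfolding len by (simp add: numeral_eq_Suc)
  moreover have "eval w a m = eval w a \<mu>" "eval w b m2 = eval w b \<mu>"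
    using Put.prems m1(3) by (auto intro!: eval_cong simp: agree_def m2_def)
  then have "agree (m3(m3 16 := m3 17)) (sem w (Put a b) \<mu>)"
    using m1(3) m3 Put.prems by (auto simp: agree_def m2_def)
  ultimately show ?case by blast
next
  case (Seq c d)
  define cc where "cc = compile c p"
  have code: "code_at P p cc" "code_at P (p + length cc) (compile d (p + length cc))"
    using Seq.prems(1) by (simp_all add: Let_def code_at_append cc_def)
  obtain m1 where m1: "reaches P w (poly (cost c) (m 1)) (p, m) (p + length cc, m1)"
    "agree m1 (sem w c \<mu>)"
    using Seq.IH(1)[of p m \<mu>] Seq.prems code unfolding cc_def by auto
  have reg: "m1 r = m r" if "r < 3" for r
    using m1(2) Seq.prems sem_constants[of c r w \<mu>] that by (auto simp: agree_def)
  obtain m2 where m2: "reaches P w (poly (cost d) (m 1)) (p + length cc, m1)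
      (p + length cc + length (compile d (p + length cc)), m2)"
    "agree m2 (sem w d (sem w c \<mu>))"
    using Seq.IH(2)[of "p + length cc" m1 "sem w c \<mu>"] Seq.prems m1 code
      reg[of 0] reg[of 1] reg[of 2] by auto
  show ?case
    using reaches_trans[OF m1(1) m2(1)] m2(2)
    by (intro exI[of _ m2]) (simp add: Let_def cc_def[symmetric] add.assoc)
next
  case (For x c)
  define cc where "cc = compile c (p + 3)"
  define C where "C = poly (cost c) (m 1)"
  define F where "F = (\<lambda>i \<mu>. sem w c (\<mu>(x := i)))"
  define q where "q = p + 4 + length cc"
  have code: "code_at P (p + 3) cc" "p + 2 < length P" "P ! p = Add x 1 0" "P ! (p + 1) = JumpZero x q"
    "P ! (p + 2) = Sub x x 2" "p + 3 + length cc < length P"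
    "P ! (p + 3 + length cc) = JumpZero 0 (p + 1)"
    using For.prems(1)
    by (simp_all add: Let_def code_at_append cc_def q_def numeral_eq_Suc)
  have x: "3 \<le> x" "x < 16" "x \<notin> assigned c" "wf_cmd c"
    using For.prems by auto
  \<comment> \<open>\<open>k\<close> rounds remain, and the counter register still holds
    \<open>k\<close> before the test; the abstract state \<open>\<xi>\<close> may carry any value of
    \<open>x\<close>.\<close>
  have loop: "\<exists>m' :: nat \<Rightarrow> nat. reaches P w (k * (C + 3) + 1) (p + 1, \<nu>) (q, m') \<and>
      agree m' ((fold F (rev [0..<k]) \<xi>)(x := 0))"
    if "agree \<nu> (\<xi>(x := k))" "\<nu> 0 = 0" "\<nu> 1 = m 1" "\<nu> 2 = 1" for k \<nu> \<xi>
    using that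
  proof (induction k arbitrary: \<nu> \<xi>)
    case 0
    then have "\<nu> x = 0" using x by (auto simp: agree_def)
    then show ?case
      using reaches_instr[of "p + 1" P "JumpZero x q" w \<nu> "(q, \<nu>)"] code 0
      by (intro exI[of _ \<nu>]) auto
  next
    case (Suc k)
    have vx: "\<nu> x = Suc k" using Suc.prems x by (auto simp: agree_def)
    have ag: "agree (\<nu>(x := k)) (\<xi>(x := k))"
      using Suc.prems(1) by (auto simp: agree_def)
    have 1: "reaches P w 1 (p + 1, \<nu>) (p + 2, \<nu>)"
      using code vx by (intro reaches_instr[where i = "JumpZero x q"]) auto
    have 2: "reaches P w 1 (p + 2, \<nu>) (p + 3, \<nu>(x := k))"
      using code vx Suc.prems
      by (intro reaches_instr[where i = "Sub x x 2"]) (auto simp: numeral_eq_Suc)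
    obtain m1 where m1: "reaches P w C (p + 3, \<nu>(x := k)) (p + 3 + length cc, m1)"
      "agree m1 (F k \<xi>)"
    proof -
      have \<nu>: "(\<nu>(x := k)) 0 = 0" "(\<nu>(x := k)) 2 = 1" "(\<nu>(x := k)) 1 = m 1"
        using x Suc.prems by auto
      show thesis
        using For.IH[OF code(1)[unfolded cc_def] x(4) ag \<nu>(1,2)] that
        unfolding cc_def C_def F_def \<nu>(3) by blast
    qed
    \<comment> \<open>The body does not assign its loop variable, so the register holds
      \<open>k\<close> after the round, as the induction hypothesis expects.\<close>
    have Fx: "F k \<xi> x = k" using sem_unassigned[of c x w "\<xi>(x := k)"] x by (simp add: F_def)
    have reg: "m1 r = \<nu> r" if "r < 3" for r
      using m1(2) Suc.prems(1) sem_constants[of c r w "\<xi>(x := k)"] that x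
      by (auto simp: agree_def F_def)
    have 3: "reaches P w 1 (p + 3 + length cc, m1) (p + 1, m1)"
      using code reg[of 0] Suc.prems by (intro reaches_instr[where i = "JumpZero 0 (p + 1)"]) auto
    have "agree m1 ((F k \<xi>)(x := k))"
      using m1(2) Fx by (metis fun_upd_triv)
    then obtain m' where m': "reaches P w (k * (C + 3) + 1) (p + 1, m1) (q, m')"
      "agree m' ((fold F (rev [0..<k]) (F k \<xi>))(x := 0))"
      using Suc.IH[of m1 "F k \<xi>"] reg[of 0] reg[of 1] reg[of 2] Suc.prems
      by (auto simp del: fun_upd_apply)
    have "reaches P w (1 + (1 + (C + (1 + (k * (C + 3) + 1))))) (p + 1, \<nu>) (q, m')"
      by (intro reaches_trans[OF 1] reaches_trans[OF 2] reaches_trans[OF m1(1)] reaches_trans[OF 3] m'(1))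
    then have "reaches P w (Suc k * (C + 3) + 1) (p + 1, \<nu>) (q, m')"
      by (rule reaches_mono) simp
    then show ?case
      using m'(2) by (intro exI conjI) (assumption, simp del: fun_upd_apply)
  qed
  have 1: "reaches P w 1 (p, m) (p + 1, m(x := m 1))"
    using code For.prems by (intro reaches_instr[where i = "Add x 1 0"]) auto
  have \<mu>1: "\<mu> 1 = m 1" using For.prems by (auto simp: agree_def)
  obtain m' where m': "reaches P w (m 1 * (C + 3) + 1) (p + 1, m(x := m 1)) (q, m')"
      "agree m' ((fold F (rev [0..<m 1]) \<mu>)(x := 0))"
  proof -
    have "agree (m(x := m 1)) (\<mu>(x := m 1))"
      using For.prems(3) by (auto simp: agree_def)
    moreover have "(m(x := m 1)) 0 = 0" "(m(x := m 1)) 1 = m 1" "(m(x := m 1)) 2 = 1"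
      using For.prems x by auto
    ultimately show thesis using loop[of "m(x := m 1)" \<mu> "m 1"] that by blast
  qed
  have "p + length (compile (For x c) p) = q"
    by (simp add: Let_def cc_def[symmetric] q_def)
  then have "reaches P w (poly (cost (For x c)) (m 1)) (p, m) (p + length (compile (For x c) p), m')"
    using reaches_trans[OF 1 m'(1)] by (elim ssubst reaches_mono) (simp add: C_def)
  then show ?case
    using m'(2) \<mu>1 by (intro exI conjI) (assumption, simp add: F_def del: fun_upd_apply)
qed

lemma poly_mono_nat: "x \<le> y \<Longrightarrow> poly p x \<le> poly p (y :: nat)"
  by (induction p) (auto intro!: add_mono mult_mono)

section \<open>Saturation\<close>

definition block :: "('a \<Rightarrow> int \<Rightarrow> 'a \<Rightarrow> bool) \<Rightarrow> ('a \<Rightarrow> 'a \<Rightarrow> bool) \<Rightarrow> 'a \<Rightarrow> 'a \<Rightarrow> bool" where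
  "block E Y s t \<longleftrightarrow> E s 0 t \<or> (\<exists>a b. E s 1 a \<and> Y a b \<and> E b (- 1) t) \<or>
     (\<exists>a b. E s (- 1) a \<and> Y a b \<and> E b 1 t)"

text \<open>With \<open>D\<close> the edges of weight \<open>1\<close> (or \<open>-1\<close>), this
  is the normal form of walks of weight \<open>k\<close> (or \<open>-k\<close>).\<close>

primrec climb :: "('a \<Rightarrow> 'a \<Rightarrow> bool) \<Rightarrow> ('a \<Rightarrow> 'a \<Rightarrow> bool) \<Rightarrow> nat \<Rightarrow> 'a \<Rightarrow> 'a \<Rightarrow> bool" where
  "climb Y D 0 s t \<longleftrightarrow> Y s t"
| "climb Y D (Suc k) s t \<longleftrightarrow> (\<exists>a b. Y s a \<and> D a b \<and> climb Y D k b t)"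

lemma climb_absorb:
  "(\<And>u. Y t u \<Longrightarrow> Y s u) \<Longrightarrow> climb Y D k t u \<Longrightarrow> climb Y D k s u"
  by (cases k) auto

text \<open>These conditions bound \<open>Y\<close> only from below, forcing it to contain all pairs
  joined by a walk of weight \<open>0\<close>. The converse for the computed table is part of the
  invariant \<open>sound\<close>.\<close>

locale saturated_relation =
  fixes E :: "'a \<Rightarrow> int \<Rightarrow> 'a \<Rightarrow> bool" and S :: "'a set" and Y :: "'a \<Rightarrow> 'a \<Rightarrow> bool"
  assumes edge: "E s z t \<Longrightarrow> s \<in> S \<and> t \<in> S \<and> z \<in> {-1, 0, 1}"
    and refl: "s \<in> S \<Longrightarrow> Y s s"
    and closed: "block E Y s t \<Longrightarrow> Y t u \<Longrightarrow> Y s u"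
begin

text \<open>A walk of weight \<open>z\<close> splits into \<open>\<bar>z\<bar>\<close> edges of the sign of \<open>z\<close>, separated by walks of
  weight \<open>0\<close> that are concatenations of blocks.\<close>
lemma walk_climb:
  assumes "walk E s z t" "s \<in> S"
  shows "(0 \<le> z \<longrightarrow> climb Y (\<lambda>a. E a 1) (nat z) s t) \<and>
    (z \<le> 0 \<longrightarrow> climb Y (\<lambda>a. E a (- 1)) (nat (- z)) s t)"
  using assms
proof (induction rule: walk.induct)
  case (walk_nil s)
  then show ?case by (simp add: refl)
next
  case (walk_step s z t z' u)
  have t: "t \<in> S" and "z \<in> {-1, 0, 1}"
    using edge[OF walk_step.hyps(1)] by auto
  note IH = walk_step.IH[OF t]
  from \<open>z \<in> {-1, 0, 1}\<close> consider "z = 0" | "z = 1" | "z = - 1"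
    by blast
  then show ?case
  proof cases
    case 1
    have "Y s v" if "Y t v" for v
      using closed[of s t v] walk_step.hyps(1) 1 that by (simp add: block_def)
    then have "climb Y D k s u" if "climb Y D k t u" for D k
      using that climb_absorb[of Y t s D k u] by blast
    then show ?thesis using IH 1 by simp
  next
    case 2
    show ?thesis
    proof (cases "0 \<le> z'")
      case True
      then have "nat (z + z') = Suc (nat z')" using 2 by simp
      then show ?thesis
        using IH True 2 refl[OF walk_step.prems] walk_step.hyps(1) by auto
    next
      case False
      \<comment> \<open>The rising edge, the first \<open>Y\<close> pair and the first falling edge
        of the chain form a block, which the next \<open>Y\<close> pair absorbs.\<close>
      then have k: "nat (- z') = Suc (nat (- (z + z')))" using 2 by simp
      then obtain a b where ab: "Y t a" "E a (- 1) b" "climb Y (\<lambda>a. E a (- 1)) (nat (- (z + z'))) b u"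
        using IH False by auto
      have "block E Y s b"
        using ab walk_step.hyps(1) 2 unfolding block_def by blast
      then have "Y s v" if "Y b v" for v
        using closed that by blast
      then have down: "climb Y (\<lambda>a. E a (- 1)) (nat (- (z + z'))) s u"
        using climb_absorb[of Y b s, OF _ ab(3)] by blast
      \<comment> \<open>For total weight \<open>0\<close> both claims reduce to
        \<open>Y s u\<close>, since \<open>climb\<close> with \<open>0\<close> edges does not
        involve \<open>D\<close>.\<close>
      then show ?thesis
        using 2 False by (cases "z + z' = 0") auto
    qed
  next
    case 3
    show ?thesis
    proof (cases "z' \<le> 0")
      case True
      then have "nat (- (z + z')) = Suc (nat (- z'))" using 3 by simp
      then show ?thesis
        using IH True 3 refl[OF walk_step.prems] walk_step.hyps(1) by auto
    next
      case False
      then have k: "nat z' = Suc (nat (z + z'))" using 3 by simp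
      then obtain a b where ab: "Y t a" "E a 1 b" "climb Y (\<lambda>a. E a 1) (nat (z + z')) b u"
        using IH False by auto
      have "block E Y s b"
        using ab walk_step.hyps(1) 3 unfolding block_def by blast
      then have "Y s v" if "Y b v" for v
        using closed that by blast
      then have up: "climb Y (\<lambda>a. E a 1) (nat (z + z')) s u"
        using climb_absorb[of Y b s, OF _ ab(3)] by blast
      then show ?thesis
        using 3 False by (cases "z + z' = 0") auto
    qed
  qed
qed

lemma zero_walk: "walk E s 0 t \<Longrightarrow> s \<in> S \<Longrightarrow> Y s t"
  using walk_climb[of s 0 t] by simp

text \<open>If the first edge has weight \<open>1\<close> or \<open>-1\<close>, the rest of the
  closed walk has the opposite weight, so its normal form contains exactly one edge, which completes
  a block with the first.\<close>

lemma zero_cycle_block: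
  assumes "zero_cycle E"
  shows "\<exists>s t. block E Y s t \<and> Y t s"
proof -
  obtain s z t where st: "E s z t" "walk E t (- z) s"
    using assms unfolding zero_cycle_def by blast
  then have t: "t \<in> S" and "z \<in> {-1, 0, 1}"
    using edge by blast+
  then consider "z = 0" | "z = 1" | "z = - 1"
    by blast
  then show ?thesis
  proof cases
    case 1
    then show ?thesis
      using zero_walk[of t s] st t unfolding block_def by auto
  next
    case 2
    then obtain a b where "Y t a" "E a (- 1) b" "Y b s"
      using walk_climb[OF st(2) t] by auto
    then have "block E Y s b \<and> Y b s"
      using st(1) 2 unfolding block_def by blast
    then show ?thesis by blast
  next
    case 3
    then obtain a b where "Y t a" "E a 1 b" "Y b s"
      using walk_climb[OF st(2) t] by auto
    then have "block E Y s b \<and> Y b s"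
      using st(1) 3 unfolding block_def by blast
    then show ?thesis by blast
  qed
qed

end

section \<open>The decision procedure\<close>

text \<open>Registers \<open>3\<close> to \<open>7\<close> are the loop variables of a sweep, register \<open>8\<close> records that a closed
  walk of weight \<open>0\<close> was found, and registers \<open>9\<close> and \<open>10\<close> count the sweeps. A table entry is
  regarded as true if it is nonzero.\<close>

definition table_entry :: "nat \<Rightarrow> nat \<Rightarrow> expr" where
  "table_entry x y = Table (Plus (TimesN (Var x)) (Var y))"

text \<open>Bit \<open>(4 * x + c) * n + y\<close> after the unary prefix and its separator, where
  \<open>c\<close> is the position of the trace in the encoding. The factor \<open>4\<close> is
  written as a sum since only multiplication by \<open>n\<close> is available.\<close>

definition trans_entry :: "nat \<Rightarrow> nat \<Rightarrow> nat \<Rightarrow> expr" where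
  "trans_entry c x y = Input (Plus (Plus (Var 1) (Num 1))
     (Plus (TimesN (Plus (Plus (Plus (Var x) (Var x)) (Plus (Var x) (Var x))) (Num c))) (Var y)))"

text \<open>Traces \<open>0\<close> and \<open>3\<close> have weight \<open>0\<close>, trace
  \<open>1\<close> has weight \<open>1\<close> and trace \<open>2\<close> has weight
  \<open>-1\<close>. On truth values read as nonzero numbers, \<open>Plus\<close> is
  disjunction.\<close>

definition block_expr :: expr where
  "block_expr = Plus (Plus (trans_entry 0 3 4) (trans_entry 3 3 4))
     (Plus (And (trans_entry 1 3 5) (And (table_entry 5 6) (trans_entry 2 6 4)))
           (And (trans_entry 2 3 5) (And (table_entry 5 6) (trans_entry 1 6 4))))"

text \<open>The three writes are reflexivity at \<open>7\<close>, composition of a block from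
  \<open>3\<close> to \<open>4\<close> with the pair \<open>(4, 7)\<close>, and recording a block
  from \<open>3\<close> to \<open>4\<close> that the pair \<open>(4, 3)\<close> closes. Registers
  \<open>5\<close> and \<open>6\<close> range over the inner pair of the block.\<close>

definition sweep_body :: cmd where
  "sweep_body =
     Seq (Put (Plus (TimesN (Var 7)) (Var 7)) (Num 1))
    (Seq (Put (Plus (TimesN (Var 3)) (Var 7))
              (Plus (table_entry 3 7) (And block_expr (table_entry 4 7))))
         (Assign 8 (Plus (Var 8) (And block_expr (table_entry 4 3)))))"

definition sweep :: cmd where
  "sweep = For 3 (For 4 (For 5 (For 6 (For 7 sweep_body))))"

definition saturate :: cmd where
  "saturate = Seq (For 9 (For 10 sweep)) sweep"

text \<open>The first five instructions count the leading ones of the input into register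
  \<open>1\<close>; at the end a zero in register \<open>8\<close> leads to
  \<open>Accept\<close>.\<close>

definition decision_program :: "instr list" where
  "decision_program =
     [Const 2 1, Read 3 1, JumpZero 3 5, Add 1 1 2, JumpZero 0 1] @ compile saturate 5 @
     [JumpZero 8 (7 + length (compile saturate 5)), Reject, Accept]"

lemma wf_saturate: "wf_cmd saturate"
  by (simp add: saturate_def sweep_def sweep_body_def block_expr_def table_entry_def trans_entry_def)

section \<open>Layout of the input word\<close>

lemma length_concat_uniform:
  "(\<And>ys. ys \<in> set yss \<Longrightarrow> length ys = L) \<Longrightarrow> length (concat yss) = length yss * L"
  by (induction yss) auto

lemma nth_concat_uniform:
  assumes "\<And>ys. ys \<in> set yss \<Longrightarrow> length ys = L" "i < length yss" "j < L"
  shows "concat yss ! (i * L + j) = yss ! i ! j"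
  using assms
proof (induction yss arbitrary: i)
  case (Cons ys yss)
  then show ?case by (cases i) (auto simp: nth_append)
qed simp

lemma index_eq_iff:
  fixes n :: nat
  assumes "j < n" "j' < n"
  shows "i * n + j = i' * n + j' \<longleftrightarrow> i = i' \<and> j = j'"
proof
  assume eq: "i * n + j = i' * n + j'"
  have "(i * n + j) div n = i" "(i' * n + j') div n = i'"
    using assms by simp_all
  then have "i = i'" using eq by metis
  then show "i = i' \<and> j = j'" using eq by simp
qed simp

locale presented_machine =
  fixes M :: "'s machine" and xs :: "'s list"
  assumes two_machine: "two_machine M" and distinct: "distinct xs" and set_xs: "set xs = states M"
begin

abbreviation n :: nat where "n \<equiv> length xs"
abbreviation w :: "bool list" where "w \<equiv> encode_machine (M, xs)"
abbreviation E :: "'s \<Rightarrow> int \<Rightarrow> 's \<Rightarrow> bool" where "E \<equiv> state_edge M"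

lemma nth_in_states: "i < n \<Longrightarrow> xs ! i \<in> states M"
  using set_xs nth_mem by blast

definition rows :: "bool list list" where
  "rows = map (\<lambda>s. concat (map (\<lambda>ab. map (\<lambda>t. t \<in> trans M s ab) xs)
     [(1, 1), (1, 2), (2, 1), (2, 2)])) xs"

lemma encode_eq: "w = replicate n True @ [False] @ concat rows"
  by (simp add: encode_machine_def rows_def)

lemma length_row: "r \<in> set rows \<Longrightarrow> length r = 4 * n"
  by (auto simp: rows_def)

lemma length_encode: "length w = n + 1 + n * (4 * n)"
  using length_concat_uniform[of rows "4 * n"] length_row
  by (simp add: encode_eq) (simp add: rows_def)

lemma input_unary: "k < n \<Longrightarrow> input_symbol w k = 1" "input_symbol w n = 0"
  by (auto simp: input_symbol_def encode_eq nth_append)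

text \<open>The table is a concatenation of rows of length \<open>4 * n\<close>, each a
  concatenation of four blocks of length \<open>n\<close>, so the bit is located by applying
  \<open>nth_concat_uniform\<close> twice.\<close>

lemma input_entry:
  assumes "i < n" "j < n" "c < 4"
  shows "input_symbol w (n + 1 + ((4 * i + c) * n + j)) =
    of_bool (xs ! j \<in> trans M (xs ! i) ([(1, 1), (1, 2), (2, 1), (2, 2)] ! c))"
proof -
  have c: "c * n + j < 4 * n"
  proof -
    have "c * n + j < (c + 1) * n" using assms by simp
    also have "\<dots> \<le> 4 * n" using assms by (intro mult_right_mono) auto
    finally show ?thesis .
  qed
  have index: "(4 * i + c) * n + j = i * (4 * n) + (c * n + j)"
    by (simp add: algebra_simps)
  have "i * (4 * n) + (c * n + j) < (i + 1) * (4 * n)" using c by simp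
  also have "\<dots> \<le> n * (4 * n)" using assms by (intro mult_right_mono) auto
  finally have less: "n + 1 + ((4 * i + c) * n + j) < length w"
    unfolding index length_encode by simp
  have "w ! (n + 1 + ((4 * i + c) * n + j)) = concat rows ! (i * (4 * n) + (c * n + j))"
    unfolding index by (simp add: encode_eq nth_append)
  also have "\<dots> = rows ! i ! (c * n + j)"
    using assms c length_row by (intro nth_concat_uniform) (auto simp: rows_def)
  also have "\<dots> = concat (map (\<lambda>ab. map (\<lambda>t. t \<in> trans M (xs ! i) ab) xs)
     [(1, 1), (1, 2), (2, 1), (2, 2)]) ! (c * n + j)"
    using assms by (simp add: rows_def)
  also have "\<dots> = map (\<lambda>ab. map (\<lambda>t. t \<in> trans M (xs ! i) ab) xs)
     [(1, 1), (1, 2), (2, 1), (2, 2)] ! c ! j"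
    using assms by (intro nth_concat_uniform) auto
  also have "\<dots> = (xs ! j \<in> trans M (xs ! i) ([(1, 1), (1, 2), (2, 1), (2, 2)] ! c))"
    using assms by (subst nth_map) auto
  finally show ?thesis
    using less by (simp add: input_symbol_def)
qed

lemma eval_trans_entry:
  assumes "m 1 = n" "m x < n" "m y < n" "c < 4"
  shows "eval w (trans_entry c x y) m \<noteq> 0 \<longleftrightarrow>
    xs ! m y \<in> trans M (xs ! m x) ([(1, 1), (1, 2), (2, 1), (2, 2)] ! c)"
proof -
  have four: "m x + m x + (m x + m x) = 4 * m x" by simp
  have "eval w (trans_entry c x y) m = input_symbol w (n + 1 + ((4 * m x + c) * n + m y))"
    unfolding trans_entry_def eval.simps four assms(1) ..
  then show ?thesis
    using input_entry[OF assms(2-4)] by simp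
qed

lemma state_edge_iff:
  assumes "i < n" "j < n"
  shows "E (xs ! i) 0 (xs ! j) \<longleftrightarrow>
      xs ! j \<in> trans M (xs ! i) (1, 1) \<or> xs ! j \<in> trans M (xs ! i) (2, 2)"
    and "E (xs ! i) 1 (xs ! j) \<longleftrightarrow> xs ! j \<in> trans M (xs ! i) (1, 2)"
    and "E (xs ! i) (- 1) (xs ! j) \<longleftrightarrow> xs ! j \<in> trans M (xs ! i) (2, 1)"
  using nth_in_states assms by (auto simp: state_edge_def trace_weight_def)

section \<open>Table invariants and the effect of one sweep\<close>

definition tbl :: "(nat \<Rightarrow> nat) \<Rightarrow> nat \<Rightarrow> nat \<Rightarrow> bool" where
  "tbl m i j \<longleftrightarrow> m (32 + (i * n + j)) \<noteq> 0"

definition idx_block :: "(nat \<Rightarrow> nat) \<Rightarrow> nat \<Rightarrow> nat \<Rightarrow> nat \<Rightarrow> nat \<Rightarrow> bool" where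
  "idx_block m i j k l \<longleftrightarrow> E (xs ! i) 0 (xs ! j) \<or>
     E (xs ! i) 1 (xs ! k) \<and> tbl m k l \<and> E (xs ! l) (- 1) (xs ! j) \<or>
     E (xs ! i) (- 1) (xs ! k) \<and> tbl m k l \<and> E (xs ! l) 1 (xs ! j)"

definition sound :: "(nat \<Rightarrow> nat) \<Rightarrow> bool" where
  "sound m \<longleftrightarrow> m 1 = n \<and> (\<forall>i < n. \<forall>j < n. tbl m i j \<longrightarrow> walk E (xs ! i) 0 (xs ! j)) \<and>
     (m 8 \<noteq> 0 \<longrightarrow> zero_cycle E)"

definition grows :: "(nat \<Rightarrow> nat) \<Rightarrow> (nat \<Rightarrow> nat) \<Rightarrow> bool" where
  "grows m m' \<longleftrightarrow> (\<forall>a. m (32 + a) \<noteq> 0 \<longrightarrow> m' (32 + a) \<noteq> 0) \<and> (m 8 \<noteq> 0 \<longrightarrow> m' 8 \<noteq> 0)"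

text \<open>The effect required of one round: premises are read in the state \<open>m\<close>
  before, conclusions in the state \<open>m'\<close> after it. With \<open>m' = m\<close> it
  expresses closure under the rules.\<close>

definition derived :: "(nat \<Rightarrow> nat) \<Rightarrow> (nat \<Rightarrow> nat) \<Rightarrow> nat \<Rightarrow> nat \<Rightarrow> nat \<Rightarrow> nat \<Rightarrow> nat \<Rightarrow> bool" where
  "derived m m' i j k l q \<longleftrightarrow> tbl m' q q \<and>
     (idx_block m i j k l \<longrightarrow> (tbl m j q \<longrightarrow> tbl m' i q) \<and> (tbl m j i \<longrightarrow> m' 8 \<noteq> 0))"

lemma grows_refl: "grows m m"
  by (simp add: grows_def)

lemma grows_trans: "grows m m' \<Longrightarrow> grows m' m'' \<Longrightarrow> grows m m''"
  by (simp add: grows_def)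

lemma grows_tbl: "grows m m' \<Longrightarrow> tbl m i j \<Longrightarrow> tbl m' i j"
  by (simp add: grows_def tbl_def)

lemma grows_idx_block: "grows m m' \<Longrightarrow> idx_block m i j k l \<Longrightarrow> idx_block m' i j k l"
  unfolding idx_block_def using grows_tbl by blast

text \<open>Premises only become easier to satisfy as the table grows, and conclusions persist, so
  the effect of one round remains valid between an earlier and a later state.\<close>

lemma derived_mono:
  assumes "grows m\<^sub>0 m" "derived m m' i j k l q" "grows m' m\<^sub>1"
  shows "derived m\<^sub>0 m\<^sub>1 i j k l q"
proof -
  have "m' 8 \<noteq> 0 \<Longrightarrow> m\<^sub>1 8 \<noteq> 0" using assms(3) by (simp add: grows_def)
  then show ?thesis
    using assms grows_tbl grows_idx_block unfolding derived_def by blast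
qed

lemma grows_upd: "x < 32 \<Longrightarrow> x \<noteq> 8 \<Longrightarrow> grows m (m(x := v))"
  by (simp add: grows_def)

lemma sound_upd: "sound m \<Longrightarrow> x < 32 \<Longrightarrow> x \<noteq> 8 \<Longrightarrow> x \<noteq> 1 \<Longrightarrow> sound (m(x := v))"
  by (simp add: sound_def tbl_def)

lemma sound_put:
  assumes "sound m" "a < n" "b < n" "v \<noteq> 0 \<Longrightarrow> walk E (xs ! a) 0 (xs ! b)"
  shows "sound (m(32 + (a * n + b) := v))"
  unfolding sound_def
proof (intro conjI allI impI)
  let ?m = "m(32 + (a * n + b) := v)"
  show "?m 1 = n" using assms(1) by (simp add: sound_def)
  show "zero_cycle E" if "?m 8 \<noteq> 0" using that assms(1) by (simp add: sound_def)
  fix i j assume ij: "i < n" "j < n" and t: "tbl ?m i j"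
  show "walk E (xs ! i) 0 (xs ! j)"
  proof (cases "i = a \<and> j = b")
    case True
    then show ?thesis using t assms(4) by (simp add: tbl_def)
  next
    case False
    then have "tbl m i j"
      using t index_eq_iff[OF ij(2) assms(3), of i a] by (auto simp: tbl_def split: if_splits)
    then show ?thesis using assms(1) ij by (simp add: sound_def)
  qed
qed

lemma eval_block_expr:
  assumes "m 1 = n" "m 3 < n" "m 4 < n" "m 5 < n" "m 6 < n"
  shows "eval w block_expr m \<noteq> 0 \<longleftrightarrow> idx_block m (m 3) (m 4) (m 5) (m 6)"
proof -
  have tab: "eval w (table_entry 5 6) m \<noteq> 0 \<longleftrightarrow> tbl m (m 5) (m 6)"
    using assms(1) by (simp add: table_entry_def tbl_def)
  have "eval w block_expr m \<noteq> 0 \<longleftrightarrow>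
      (eval w (trans_entry 0 3 4) m \<noteq> 0 \<or> eval w (trans_entry 3 3 4) m \<noteq> 0) \<or>
      eval w (trans_entry 1 3 5) m \<noteq> 0 \<and> tbl m (m 5) (m 6) \<and> eval w (trans_entry 2 6 4) m \<noteq> 0 \<or>
      eval w (trans_entry 2 3 5) m \<noteq> 0 \<and> tbl m (m 5) (m 6) \<and> eval w (trans_entry 1 6 4) m \<noteq> 0"
    unfolding block_expr_def tab[symmetric] by simp
  then show ?thesis
    using eval_trans_entry[of m 3 4 0] eval_trans_entry[of m 3 4 3] eval_trans_entry[of m 3 5 1]
      eval_trans_entry[of m 6 4 2] eval_trans_entry[of m 3 5 2] eval_trans_entry[of m 6 4 1] assms
    by (simp add: idx_block_def state_edge_iff)
qed

text \<open>A block is a nonempty walk of weight \<open>0\<close>; keeping its first edge apart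
  yields a \<open>zero_cycle\<close> as soon as a table entry leads back.\<close>

lemma idx_block_walk:
  assumes "sound m" "i < n" "j < n" "k < n" "l < n" "idx_block m i j k l"
  shows "walk E (xs ! i) 0 (xs ! j)"
    and "tbl m j i \<Longrightarrow> zero_cycle E"
proof -
  have tbl: "walk E (xs ! a) 0 (xs ! b)" if "tbl m a b" "a < n" "b < n" for a b
    using that assms(1) by (simp add: sound_def)
  have *: "\<exists>z t. E (xs ! i) z t \<and> walk E t (- z) (xs ! j)"
  proof -
    consider "E (xs ! i) 0 (xs ! j)"
      | "E (xs ! i) 1 (xs ! k)" "tbl m k l" "E (xs ! l) (- 1) (xs ! j)"
      | "E (xs ! i) (- 1) (xs ! k)" "tbl m k l" "E (xs ! l) 1 (xs ! j)"
      using assms(6) unfolding idx_block_def by blast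
    then show ?thesis
    proof cases
      case 1
      then show ?thesis using walk_nil[of E "xs ! j"] by force
    next
      case 2
      then show ?thesis
        using walk_append[OF tbl[OF 2(2) assms(4,5)] walk_single[of E, OF 2(3)]]
        by (intro exI[of _ 1] exI[of _ "xs ! k"]) simp
    next
      case 3
      then show ?thesis
        using walk_append[OF tbl[OF 3(2) assms(4,5)] walk_single[of E, OF 3(3)]]
        by (intro exI[of _ "- 1"] exI[of _ "xs ! k"]) simp
    qed
  qed
  then obtain z t where zt: "E (xs ! i) z t" "walk E t (- z) (xs ! j)"
    by blast
  show "walk E (xs ! i) 0 (xs ! j)"
    using walk_step[of E, OF zt] by simp
  show "zero_cycle E" if "tbl m j i"
    using zt(1) walk_append[OF zt(2) tbl[OF that assms(3,2)]] unfolding zero_cycle_def by auto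
qed

lemma sweep_body_correct:
  assumes "sound m" "m 3 < n" "m 4 < n" "m 5 < n" "m 6 < n" "m 7 < n"
  shows "sound (sem w sweep_body m) \<and> grows m (sem w sweep_body m) \<and>
    (\<forall>r \<in> {3..7}. sem w sweep_body m r = m r) \<and>
    derived m (sem w sweep_body m) (m 3) (m 4) (m 5) (m 6) (m 7)"
proof -
  have m1n: "m 1 = n" using assms(1) by (simp add: sound_def)
  define m1 where "m1 = m(32 + (m 7 * n + m 7) := 1)"
  define v where "v = eval w (Plus (table_entry 3 7) (And block_expr (table_entry 4 7))) m1"
  define m2 where "m2 = m1(32 + (m 3 * n + m 7) := v)"
  define b where "b = eval w (And block_expr (table_entry 4 3)) m2"
  have sem: "sem w sweep_body m = m2(8 := m2 8 + b)"
    using m1n by (simp add: sweep_body_def m1_def m2_def v_def b_def)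
  have reg1: "m1 r = m r" and reg2: "m2 r = m r" if "r < 32" for r
    using that by (simp_all add: m1_def m2_def)
  have s1: "sound m1"
    unfolding m1_def using assms by (intro sound_put) (auto intro: walk_nil)
  have g1: "grows m m1"
    by (simp add: m1_def grows_def)
  have block1: "eval w block_expr m1 \<noteq> 0 \<longleftrightarrow> idx_block m1 (m 3) (m 4) (m 5) (m 6)"
    using eval_block_expr[of m1] assms m1n by (simp add: reg1)
  have v: "v \<noteq> 0 \<longleftrightarrow> tbl m1 (m 3) (m 7) \<or> idx_block m1 (m 3) (m 4) (m 5) (m 6) \<and> tbl m1 (m 4) (m 7)"
    using m1n unfolding block1[symmetric] by (simp add: v_def table_entry_def tbl_def reg1)
  have s2: "sound m2"
    unfolding m2_def
  proof (rule sound_put[OF s1])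
    assume "v \<noteq> 0"
    then consider "tbl m1 (m 3) (m 7)"
      | "idx_block m1 (m 3) (m 4) (m 5) (m 6)" "tbl m1 (m 4) (m 7)"
      using v by blast
    then show "walk E (xs ! m 3) 0 (xs ! m 7)"
    proof cases
      case 1
      then show ?thesis using s1 assms by (simp add: sound_def)
    next
      case 2
      then have "walk E (xs ! m 4) 0 (xs ! m 7)" using s1 assms by (simp add: sound_def)
      then show ?thesis
        using walk_append[OF idx_block_walk(1)[OF s1 _ _ _ _ 2(1)]] assms by fastforce
    qed
  qed (use assms in auto)
  \<comment> \<open>The old entry is a summand of \<open>v\<close>, so overwriting never clears a
    true entry, not even the diagonal one just set.\<close>
  have g2: "grows m1 m2"
    using v by (simp add: m2_def grows_def tbl_def)
  have block2: "eval w block_expr m2 \<noteq> 0 \<longleftrightarrow> idx_block m2 (m 3) (m 4) (m 5) (m 6)"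
    using eval_block_expr[of m2] assms m1n by (simp add: reg2)
  have b: "b \<noteq> 0 \<longleftrightarrow> idx_block m2 (m 3) (m 4) (m 5) (m 6) \<and> tbl m2 (m 4) (m 3)"
    using m1n unfolding block2[symmetric] by (simp add: b_def table_entry_def tbl_def reg2)
  have "zero_cycle E" if "m2 8 + b \<noteq> 0"
  proof (cases "b = 0")
    case True
    then show ?thesis using that s2 by (simp add: sound_def)
  next
    case False
    then show ?thesis
      using b idx_block_walk(2)[OF s2] assms by blast
  qed
  then have s3: "sound (m2(8 := m2 8 + b))"
    using s2 by (simp add: sound_def tbl_def)
  have g3: "grows m2 (m2(8 := m2 8 + b))"
    by (simp add: grows_def)
  have "derived m (m2(8 := m2 8 + b)) (m 3) (m 4) (m 5) (m 6) (m 7)"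
  proof -
    have "tbl m1 (m 7) (m 7)" by (simp add: m1_def tbl_def)
    then have 1: "tbl (m2(8 := m2 8 + b)) (m 7) (m 7)"
      using grows_tbl grows_trans[OF g2 g3] by blast
    have 2: "tbl (m2(8 := m2 8 + b)) (m 3) (m 7)"
      if "idx_block m (m 3) (m 4) (m 5) (m 6)" "tbl m (m 4) (m 7)"
    proof -
      have "v \<noteq> 0"
        using that v grows_idx_block[OF g1] grows_tbl[OF g1] by blast
      then show ?thesis by (simp add: m2_def tbl_def)
    qed
    have 3: "b \<noteq> 0" if "idx_block m (m 3) (m 4) (m 5) (m 6)" "tbl m (m 4) (m 3)"
      using that b grows_trans[OF g1 g2] grows_idx_block grows_tbl by blast
    show ?thesis
      unfolding derived_def using 1 2 3 by simp
  qed
  then show ?thesis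
    unfolding sem using s3 grows_trans[OF grows_trans[OF g1 g2] g3] reg2 by auto
qed

text \<open>A loop rule for nesting: \<open>Q\<close> fixes the outer loop variables, and
  \<open>G v\<close> is the effect of round \<open>v\<close>, stable under growth so that it
  survives the other rounds and the writes to the counter.\<close>

lemma For_correct:
  assumes body: "\<And>m v. sound m \<Longrightarrow> v < n \<Longrightarrow> Q m \<Longrightarrow> m x = v \<Longrightarrow>
      sound (sem w c m) \<and> grows m (sem w c m) \<and> Q (sem w c m) \<and> G v m (sem w c m)"
    and Q: "\<And>m v. Q m \<Longrightarrow> Q (m(x := v))"
    and x: "x < 32" "x \<noteq> 8" "x \<noteq> 1"
    and G: "\<And>v m\<^sub>0 m m' m\<^sub>1. grows m\<^sub>0 m \<Longrightarrow> G v m m' \<Longrightarrow> grows m' m\<^sub>1 \<Longrightarrow> G v m\<^sub>0 m\<^sub>1"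
    and m: "sound m" "Q m"
  shows "sound (sem w (For x c) m) \<and> grows m (sem w (For x c) m) \<and> Q (sem w (For x c) m) \<and>
    (\<forall>v < n. G v m (sem w (For x c) m))"
proof -
  define F where "F = (\<lambda>i \<mu>. sem w c (\<mu>(x := i)))"
  have loop: "sound (fold F (rev [0..<k]) \<mu>) \<and> grows \<mu> (fold F (rev [0..<k]) \<mu>) \<and>
      Q (fold F (rev [0..<k]) \<mu>) \<and> (\<forall>v < k. G v \<mu> (fold F (rev [0..<k]) \<mu>))"
    if "sound \<mu>" "Q \<mu>" "k \<le> n" for k \<mu>
    using that
  proof (induction k arbitrary: \<mu>)
    case 0
    then show ?case by (simp add: grows_refl)
  next
    case (Suc k)
    have step: "sound (F k \<mu>) \<and> grows (\<mu>(x := k)) (F k \<mu>) \<and> Q (F k \<mu>) \<and> G k (\<mu>(x := k)) (F k \<mu>)"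
      unfolding F_def using Suc.prems x sound_upd Q by (intro body) auto
    then have g: "grows \<mu> (F k \<mu>)"
      using grows_trans[OF grows_upd] x by blast
    define \<nu> where "\<nu> = fold F (rev [0..<k]) (F k \<mu>)"
    have \<nu>: "sound \<nu> \<and> grows (F k \<mu>) \<nu> \<and> Q \<nu> \<and> (\<forall>v < k. G v (F k \<mu>) \<nu>)"
      unfolding \<nu>_def using Suc.IH[of "F k \<mu>"] step Suc.prems by simp
    have "G v \<mu> \<nu>" if "v < Suc k" for v
    proof (cases "v = k")
      case True
      have "grows \<mu> (\<mu>(x := k))" using x by (intro grows_upd)
      then show ?thesis using G step \<nu> True by blast
    next
      case False
      then have "G v (F k \<mu>) \<nu>" using \<nu> that by simp
      then show ?thesis using G g grows_refl by blast
    qed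
    moreover have "fold F (rev [0..<Suc k]) \<mu> = \<nu>" by (simp add: \<nu>_def)
    ultimately show ?case
      using \<nu> grows_trans[OF g] by simp
  qed
  have mn: "m 1 = n" using m by (simp add: sound_def)
  define \<nu> where "\<nu> = fold F (rev [0..<n]) m"
  have \<nu>: "sound \<nu> \<and> grows m \<nu> \<and> Q \<nu> \<and> (\<forall>v < n. G v m \<nu>)"
    unfolding \<nu>_def using loop[OF m] by simp
  have up: "grows \<nu> (\<nu>(x := 0))" using x by (intro grows_upd)
  have "sem w (For x c) m = \<nu>(x := 0)" using mn by (simp add: \<nu>_def F_def)
  then show ?thesis
    using \<nu> up sound_upd[of \<nu> x 0] x Q grows_trans[OF _ up] G[OF grows_refl _ up] by auto
qed

text \<open>\<open>For_correct\<close> is applied from the innermost loop outwards, each time adding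
  one quantifier to the effect.\<close>

lemma sweep_correct:
  assumes "sound m"
  shows "sound (sem w sweep m) \<and> grows m (sem w sweep m) \<and>
    (\<forall>i < n. \<forall>j < n. \<forall>k < n. \<forall>l < n. \<forall>q < n. derived m (sem w sweep m) i j k l q)"
proof -
  have loop7: "sound (sem w (For 7 sweep_body) m) \<and> grows m (sem w (For 7 sweep_body) m) \<and>
      (sem w (For 7 sweep_body) m 3 = i \<and> sem w (For 7 sweep_body) m 4 = j \<and>
       sem w (For 7 sweep_body) m 5 = k \<and> sem w (For 7 sweep_body) m 6 = l) \<and>
      (\<forall>q < n. derived m (sem w (For 7 sweep_body) m) i j k l q)"
    if "i < n" "j < n" "k < n" "l < n" "sound m" "m 3 = i \<and> m 4 = j \<and> m 5 = k \<and> m 6 = l" for i j k l m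
  proof (rule For_correct[where Q = "\<lambda>m. m 3 = i \<and> m 4 = j \<and> m 5 = k \<and> m 6 = l"
        and G = "\<lambda>q m m'. derived m m' i j k l q" and m = m])
    fix \<mu> v assume "sound \<mu>" "v < n" "\<mu> 3 = i \<and> \<mu> 4 = j \<and> \<mu> 5 = k \<and> \<mu> 6 = l" "\<mu> 7 = v"
    then show "sound (sem w sweep_body \<mu>) \<and> grows \<mu> (sem w sweep_body \<mu>) \<and>
      (sem w sweep_body \<mu> 3 = i \<and> sem w sweep_body \<mu> 4 = j \<and> sem w sweep_body \<mu> 5 = k \<and>
       sem w sweep_body \<mu> 6 = l) \<and> derived \<mu> (sem w sweep_body \<mu>) i j k l v"
      using sweep_body_correct[of \<mu>] that by simp
  qed (use that derived_mono in auto)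
  define c6 where "c6 = For 7 sweep_body"
  have loop6: "sound (sem w (For 6 c6) m) \<and> grows m (sem w (For 6 c6) m) \<and>
      (sem w (For 6 c6) m 3 = i \<and> sem w (For 6 c6) m 4 = j \<and> sem w (For 6 c6) m 5 = k) \<and>
      (\<forall>l < n. \<forall>q < n. derived m (sem w (For 6 c6) m) i j k l q)"
    if "i < n" "j < n" "k < n" "sound m" "m 3 = i \<and> m 4 = j \<and> m 5 = k" for i j k m
  proof (rule For_correct[where Q = "\<lambda>m. m 3 = i \<and> m 4 = j \<and> m 5 = k"
        and G = "\<lambda>l m m'. \<forall>q < n. derived m m' i j k l q" and m = m])
    fix \<mu> v assume "sound \<mu>" "v < n" "\<mu> 3 = i \<and> \<mu> 4 = j \<and> \<mu> 5 = k" "\<mu> 6 = v"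
    then show "sound (sem w c6 \<mu>) \<and> grows \<mu> (sem w c6 \<mu>) \<and>
      (sem w c6 \<mu> 3 = i \<and> sem w c6 \<mu> 4 = j \<and> sem w c6 \<mu> 5 = k) \<and>
      (\<forall>q < n. derived \<mu> (sem w c6 \<mu>) i j k v q)"
      using loop7[of i j k v \<mu>] that unfolding c6_def by blast
  next
    fix v m\<^sub>0 m m' m\<^sub>1
    assume g: "grows m\<^sub>0 m" "grows m' m\<^sub>1" and d: "\<forall>q < n. derived m m' i j k v q"
    show "\<forall>q < n. derived m\<^sub>0 m\<^sub>1 i j k v q"
      using derived_mono[OF g(1) _ g(2)] d by blast
  qed (use that in auto)
  define c5 where "c5 = For 6 c6"
  have loop5: "sound (sem w (For 5 c5) m) \<and> grows m (sem w (For 5 c5) m) \<and>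
      (sem w (For 5 c5) m 3 = i \<and> sem w (For 5 c5) m 4 = j) \<and>
      (\<forall>k < n. \<forall>l < n. \<forall>q < n. derived m (sem w (For 5 c5) m) i j k l q)"
    if "i < n" "j < n" "sound m" "m 3 = i \<and> m 4 = j" for i j m
  proof (rule For_correct[where Q = "\<lambda>m. m 3 = i \<and> m 4 = j"
        and G = "\<lambda>k m m'. \<forall>l < n. \<forall>q < n. derived m m' i j k l q" and m = m])
    fix \<mu> v assume "sound \<mu>" "v < n" "\<mu> 3 = i \<and> \<mu> 4 = j" "\<mu> 5 = v"
    then show "sound (sem w c5 \<mu>) \<and> grows \<mu> (sem w c5 \<mu>) \<and>
      (sem w c5 \<mu> 3 = i \<and> sem w c5 \<mu> 4 = j) \<and>
      (\<forall>l < n. \<forall>q < n. derived \<mu> (sem w c5 \<mu>) i j v l q)"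
      using loop6[of i j v \<mu>] that unfolding c5_def by blast
  next
    fix v m\<^sub>0 m m' m\<^sub>1
    assume g: "grows m\<^sub>0 m" "grows m' m\<^sub>1" and d: "\<forall>l < n. \<forall>q < n. derived m m' i j v l q"
    show "\<forall>l < n. \<forall>q < n. derived m\<^sub>0 m\<^sub>1 i j v l q"
      using derived_mono[OF g(1) _ g(2)] d by blast
  qed (use that in auto)
  define c4 where "c4 = For 5 c5"
  have loop4: "sound (sem w (For 4 c4) m) \<and> grows m (sem w (For 4 c4) m) \<and>
      sem w (For 4 c4) m 3 = i \<and>
      (\<forall>j < n. \<forall>k < n. \<forall>l < n. \<forall>q < n. derived m (sem w (For 4 c4) m) i j k l q)"
    if "i < n" "sound m" "m 3 = i" for i m
  proof (rule For_correct[where Q = "\<lambda>m. m 3 = i"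
        and G = "\<lambda>j m m'. \<forall>k < n. \<forall>l < n. \<forall>q < n. derived m m' i j k l q" and m = m])
    fix \<mu> v assume "sound \<mu>" "v < n" "\<mu> 3 = i" "\<mu> 4 = v"
    then show "sound (sem w c4 \<mu>) \<and> grows \<mu> (sem w c4 \<mu>) \<and> sem w c4 \<mu> 3 = i \<and>
      (\<forall>k < n. \<forall>l < n. \<forall>q < n. derived \<mu> (sem w c4 \<mu>) i v k l q)"
      using loop5[of i v \<mu>] that unfolding c4_def by blast
  next
    fix v m\<^sub>0 m m' m\<^sub>1
    assume g: "grows m\<^sub>0 m" "grows m' m\<^sub>1" and d: "\<forall>k < n. \<forall>l < n. \<forall>q < n. derived m m' i v k l q"
    show "\<forall>k < n. \<forall>l < n. \<forall>q < n. derived m\<^sub>0 m\<^sub>1 i v k l q"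
      using derived_mono[OF g(1) _ g(2)] d by blast
  qed (use that in auto)
  define c3 where "c3 = For 4 c4"
  have "sound (sem w (For 3 c3) m) \<and> grows m (sem w (For 3 c3) m) \<and> True \<and>
      (\<forall>i < n. \<forall>j < n. \<forall>k < n. \<forall>l < n. \<forall>q < n. derived m (sem w (For 3 c3) m) i j k l q)"
  proof (rule For_correct[where Q = "\<lambda>m. True"
        and G = "\<lambda>i m m'. \<forall>j < n. \<forall>k < n. \<forall>l < n. \<forall>q < n. derived m m' i j k l q" and m = m])
    fix \<mu> v assume "sound \<mu>" "v < n" "\<mu> 3 = v"
    then show "sound (sem w c3 \<mu>) \<and> grows \<mu> (sem w c3 \<mu>) \<and> True \<and>
      (\<forall>j < n. \<forall>k < n. \<forall>l < n. \<forall>q < n. derived \<mu> (sem w c3 \<mu>) v j k l q)"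
      using loop4[of v \<mu>] unfolding c3_def by blast
  next
    fix v m\<^sub>0 m m' m\<^sub>1
    assume g: "grows m\<^sub>0 m" "grows m' m\<^sub>1" and d: "\<forall>j < n. \<forall>k < n. \<forall>l < n. \<forall>q < n. derived m m' v j k l q"
    show "\<forall>j < n. \<forall>k < n. \<forall>l < n. \<forall>q < n. derived m\<^sub>0 m\<^sub>1 v j k l q"
      using derived_mono[OF g(1) _ g(2)] d by blast
  qed (use assms in auto)
  then show ?thesis
    unfolding sweep_def c3_def c4_def c5_def c6_def by blast
qed

definition saturated :: "(nat \<Rightarrow> nat) \<Rightarrow> bool" where
  "saturated m \<longleftrightarrow> (\<forall>i < n. \<forall>j < n. \<forall>k < n. \<forall>l < n. \<forall>q < n. derived m m i j k l q)"

text \<open>The table, transported from indices to states as \<open>Y\<close>, is a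
  \<open>saturated_relation\<close>; distinctness of \<open>xs\<close> brings the conclusions back
  to indices.\<close>

lemma saturated_complete:
  assumes "saturated m"
  shows "i < n \<Longrightarrow> j < n \<Longrightarrow> walk E (xs ! i) 0 (xs ! j) \<Longrightarrow> tbl m i j"
    and "zero_cycle E \<Longrightarrow> m 8 \<noteq> 0"
proof -
  define Y where "Y s t \<longleftrightarrow> (\<exists>i < n. \<exists>j < n. s = xs ! i \<and> t = xs ! j \<and> tbl m i j)" for s t
  have idx: "\<exists>i < n. s = xs ! i" if "s \<in> states M" for s
    using that set_xs by (metis in_set_conv_nth)
  have inj: "i = j" if "xs ! i = xs ! j" "i < n" "j < n" for i j
    using that distinct nth_eq_iff_index_eq by blast
  have d: "derived m m i j k l q" if "i < n" "j < n" "k < n" "l < n" "q < n" for i j k l q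
    using assms that unfolding saturated_def by blast
  have blk: "\<exists>k < n. \<exists>l < n. idx_block m i j k l" 
    if b: "block E Y (xs ! i) (xs ! j)" and ij: "i < n" "j < n" for i j
  proof -
    consider "E (xs ! i) 0 (xs ! j)"
      | a b where "E (xs ! i) 1 a" "Y a b" "E b (- 1) (xs ! j)"
      | a b where "E (xs ! i) (- 1) a" "Y a b" "E b 1 (xs ! j)"
      using b unfolding block_def by blast
    then show ?thesis
    proof cases
      case 1
      then show ?thesis using ij unfolding idx_block_def by blast
    next
      case 2
      then obtain k l where "k < n" "l < n" "a = xs ! k" "b = xs ! l" "tbl m k l"
        unfolding Y_def by blast
      then show ?thesis using 2 unfolding idx_block_def by blast
    next
      case 3
      then obtain k l where "k < n" "l < n" "a = xs ! k" "b = xs ! l" "tbl m k l"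
        unfolding Y_def by blast
      then show ?thesis using 3 unfolding idx_block_def by blast
    qed
  qed
  have block_dom: "s \<in> states M \<and> t \<in> states M" if "block E Y s t" for s t
    using that unfolding block_def state_edge_def by blast
  interpret saturated_relation E "states M" Y
  proof
    show "s \<in> states M \<and> t \<in> states M \<and> z \<in> {- 1, 0, 1}" if "E s z t" for s z t
      using that state_edge_weight[OF that] by (simp add: state_edge_def)
    show "Y s s" if s: "s \<in> states M" for s
    proof -
      obtain i where "i < n" "s = xs ! i" using idx[OF s] by blast
      then show ?thesis
        using d[of i i i i i] unfolding Y_def derived_def by blast
    qed
    show "Y s u" if st: "block E Y s t" and tu: "Y t u" for s t u
    proof -
      obtain i where i: "i < n" "s = xs ! i" using idx block_dom[OF st] by blast
      obtain j q where jq: "j < n" "q < n" "t = xs ! j" "u = xs ! q" "tbl m j q"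
        using tu unfolding Y_def by blast
      obtain k l where kl: "k < n" "l < n" "idx_block m i j k l"
        using blk[of i j] st i jq by blast
      have "tbl m i q"
        using d[OF i(1) jq(1) kl(1,2) jq(2)] kl(3) jq(5) unfolding derived_def by blast
      then show ?thesis using i jq unfolding Y_def by blast
    qed
  qed
  show "tbl m i j" if ij: "i < n" "j < n" and wlk: "walk E (xs ! i) 0 (xs ! j)"
  proof -
    have "Y (xs ! i) (xs ! j)" using zero_walk[OF wlk] nth_in_states ij by blast
    then obtain a b where "a < n" "b < n" "xs ! i = xs ! a" "xs ! j = xs ! b" "tbl m a b"
      unfolding Y_def by blast
    then show ?thesis using inj[of i a] inj[of j b] ij by simp
  qed
  show "m 8 \<noteq> 0" if zero: "zero_cycle E"
  proof -
    obtain s t where st: "block E Y s t" "Y t s" using zero_cycle_block[OF zero] by blast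
    then obtain i j where ij: "i < n" "j < n" "s = xs ! i" "t = xs ! j" "tbl m j i"
      unfolding Y_def by blast
    obtain k l where kl: "k < n" "l < n" "idx_block m i j k l"
      using blk[of i j] st ij by blast
    show ?thesis
      using d[OF ij(1,2) kl(1,2) ij(1)] kl(3) ij(5) unfolding derived_def by blast
  qed
qed

section \<open>Counting sweeps until saturation\<close>

definition pairs :: "(nat \<Rightarrow> nat) \<Rightarrow> (nat \<times> nat) set" where
  "pairs m = {(i, j). i < n \<and> j < n \<and> tbl m i j}"

definition progress :: "nat \<Rightarrow> (nat \<Rightarrow> nat) \<Rightarrow> bool" where
  "progress k m \<longleftrightarrow> sound m \<and> (saturated m \<or> k \<le> card (pairs m))"

lemma pairs_subset: "pairs m \<subseteq> {..<n} \<times> {..<n}"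
  by (auto simp: pairs_def)

text \<open>If a sweep adds no pair, the premises read before and after it coincide, so the effects
  of the sweep are closure of the final table.\<close>

lemma saturated_cong:
  assumes "pairs m = pairs m'"
    and "\<And>i j k l q. i < n \<Longrightarrow> j < n \<Longrightarrow> k < n \<Longrightarrow> l < n \<Longrightarrow> q < n \<Longrightarrow> derived m m' i j k l q"
  shows "saturated m'"
proof -
  have tbl: "tbl m i j = tbl m' i j" if "i < n" "j < n" for i j
  proof -
    have "(i, j) \<in> pairs m \<longleftrightarrow> (i, j) \<in> pairs m'" using assms(1) by simp
    then show ?thesis using that by (simp add: pairs_def)
  qed
  have ib: "idx_block m i j k l = idx_block m' i j k l" if "k < n" "l < n" for i j k l
    unfolding idx_block_def tbl[OF that] ..
  show ?thesis
    unfolding saturated_def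
  proof (intro allI impI)
    fix i j k l q assume "i < n" "j < n" "k < n" "l < n" "q < n"
    then show "derived m' m' i j k l q"
      using assms(2)[of i j k l q] by (simp add: derived_def ib tbl)
  qed
qed

lemma progress_sweep:
  assumes "progress k m"
  shows "progress (Suc k) (sem w sweep m)"
proof -
  let ?m = "sem w sweep m"
  have m: "sound m" using assms by (simp add: progress_def)
  have s: "sound ?m" and g: "grows m ?m"
    and d: "\<And>i j k l q. i < n \<Longrightarrow> j < n \<Longrightarrow> k < n \<Longrightarrow> l < n \<Longrightarrow> q < n \<Longrightarrow> derived m ?m i j k l q"
    using sweep_correct[OF m] by blast+
  have sub: "pairs m \<subseteq> pairs ?m"
    using grows_tbl[OF g] by (auto simp: pairs_def)
  have fin: "finite (pairs ?m)"
    using pairs_subset by (rule finite_subset) simp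
  show ?thesis
  proof (cases "pairs m = pairs ?m")
    case True
    then show ?thesis
      using saturated_cong[OF True d] s by (simp add: progress_def)
  next
    case False
    \<comment> \<open>A saturated table contains all pairs joined by walks of weight
      \<open>0\<close>, and a sound sweep adds only such pairs.\<close>
    have "\<not> saturated m"
    proof
      assume sat: "saturated m"
      have "pairs ?m \<subseteq> pairs m"
        using saturated_complete(1)[OF sat] s unfolding pairs_def sound_def by blast
      then show False using False sub by blast
    qed
    then have "k \<le> card (pairs m)" using assms by (simp add: progress_def)
    also have "\<dots> < card (pairs ?m)"
      using sub False fin by (intro psubset_card_mono) auto
    finally show ?thesis using s by (simp add: progress_def)
  qed
qed

lemma progress_upd: "progress k m \<Longrightarrow> x < 32 \<Longrightarrow> x \<noteq> 8 \<Longrightarrow> x \<noteq> 1 \<Longrightarrow> progress k (m(x := v))"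
proof -
  assume a: "progress k m" "x < 32" "x \<noteq> 8" "x \<noteq> 1"
  have t: "tbl (m(x := v)) = tbl m" using a by (intro ext) (simp add: tbl_def)
  have ib: "idx_block (m(x := v)) = idx_block m" by (intro ext) (simp add: idx_block_def t)
  have "saturated (m(x := v)) = saturated m" "pairs (m(x := v)) = pairs m"
    using a by (simp_all add: saturated_def derived_def pairs_def t ib)
  then show ?thesis using a sound_upd[of m x v] by (simp add: progress_def)
qed

lemma progress_For:
  assumes step: "\<And>k m. progress k m \<Longrightarrow> progress (k + d) (sem w c m)"
    and x: "x < 32" "x \<noteq> 8" "x \<noteq> 1" and m: "progress k m"
  shows "progress (k + n * d) (sem w (For x c) m)"
proof -
  have loop: "progress (k + length is * d) (fold (\<lambda>i \<mu>. sem w c (\<mu>(x := i))) is \<mu>)"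
    if "progress k \<mu>" for "is" k \<mu>
    using that
  proof (induction "is" arbitrary: k \<mu>)
    case (Cons i "is")
    have "progress (k + d) (sem w c (\<mu>(x := i)))"
      using step progress_upd[OF Cons.prems x] by blast
    from Cons.IH[OF this] show ?case by (simp add: algebra_simps del: fun_upd_apply)
  qed simp
  have "m 1 = n" using m by (simp add: progress_def sound_def)
  then show ?thesis
    using progress_upd[OF loop[OF m, of "rev [0..<n]"] x] by simp
qed

text \<open>After \<open>n * n + 1\<close> sweeps the table would need more than
  \<open>n * n\<close> entries unless it is saturated. Soundness and completeness then fix the
  meaning of register \<open>8\<close>.\<close>

lemma saturate_correct:
  assumes "sound m"
  shows "sem w saturate m 8 \<noteq> 0 \<longleftrightarrow> zero_cycle E"
proof -
  have 0: "progress 0 m" using assms by (simp add: progress_def)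
  have "progress (k + n * 1) (sem w (For 10 sweep) \<mu>)" if "progress k \<mu>" for k \<mu>
    by (rule progress_For) (use progress_sweep that in auto)
  then have "progress (0 + n * (n * 1)) (sem w (For 9 (For 10 sweep)) m)"
    by (rule progress_For) (use 0 in auto)
  from progress_sweep[OF this]
  have p: "progress (Suc (n * n)) (sem w saturate m)"
    by (simp add: saturate_def)
  have "card (pairs m') \<le> n * n" for m'
    using card_mono[OF _ pairs_subset[of m']] by simp
  then have "saturated (sem w saturate m)"
    using p by (metis Suc_n_not_le_n le_trans progress_def)
  then show ?thesis
    using saturated_complete(2) p unfolding progress_def sound_def by blast
qed

text \<open>Composes four phases: counting the states, leaving at the separator, the compiled
  saturation and the final jump.\<close>

lemma decision_program_correct:
  "halts_within decision_program w (poly ([:4, 4:] + cost saturate) (length w))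
     (if zero_cycle E then Reject else Accept)"
proof -
  let ?P = decision_program
  define L where "L = length (compile saturate 5)"
  define st :: "nat \<Rightarrow> nat \<Rightarrow> nat \<Rightarrow> nat" where "st k c = (\<lambda>_. 0)(2 := 1, 1 := k, 3 := c)" for k c
  have code: "?P ! 0 = Const 2 1" "?P ! 1 = Read 3 1" "?P ! 2 = JumpZero 3 5" "?P ! 3 = Add 1 1 2"
    "?P ! 4 = JumpZero 0 1" "?P ! (5 + L) = JumpZero 8 (7 + L)" "?P ! (6 + L) = Reject"
    "?P ! (7 + L) = Accept"
    by (simp_all add: decision_program_def L_def nth_append)
  have len: "length ?P = 8 + L"
    by (simp add: decision_program_def L_def)
  have five: "length [Const 2 1, Read 3 1, JumpZero 3 5, Add 1 1 2, JumpZero 0 1] = 5"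
    by simp
  have main: "code_at ?P 5 (compile saturate 5)"
    using code_at_middle[of "[Const 2 1, Read 3 1, JumpZero 3 5, Add 1 1 2, JumpZero 0 1]"
        "compile saturate 5" "[JumpZero 8 (7 + length (compile saturate 5)), Reject, Accept]"]
    unfolding decision_program_def five .
  \<comment> \<open>Register \<open>3\<close> holds the last symbol read, which is \<open>1\<close>
    in the prefix, and its initial value \<open>0\<close> before any reading.\<close>
  have count: "reaches ?P w (1 + 4 * k) (0, \<lambda>_. 0) (1, st k (of_bool (k > 0)))" if "k \<le> n" for k
    using that
  proof (induction k)
    case 0
    have "reaches ?P w 1 (0, \<lambda>_. 0) (1, st 0 0)"
      using code len by (intro reaches_instr[where i = "Const 2 1"]) (auto simp: st_def)
    then show ?case by simp
  next
    case (Suc k)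
    have 1: "reaches ?P w 1 (1, st k c) (2, st k 1)" for c
      using code len input_unary(1)[of k] Suc.prems
      by (intro reaches_instr[where i = "Read 3 1"]) (auto simp: st_def)
    have 2: "reaches ?P w 1 (2, st k 1) (3, st k 1)"
      using code len by (intro reaches_instr[where i = "JumpZero 3 5"]) (auto simp: st_def)
    have 3: "reaches ?P w 1 (3, st k 1) (4, st (Suc k) 1)"
      using code len by (intro reaches_instr[where i = "Add 1 1 2"]) (auto simp: st_def)
    have 4: "reaches ?P w 1 (4, st (Suc k) 1) (1, st (Suc k) 1)"
      using code len by (intro reaches_instr[where i = "JumpZero 0 1"]) (auto simp: st_def)
    have "reaches ?P w (1 + 4 * k + (1 + (1 + (1 + 1)))) (0, \<lambda>_. 0) (1, st (Suc k) 1)"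
      using Suc
      by (intro reaches_trans[OF _ reaches_trans[OF 1 reaches_trans[OF 2 reaches_trans[OF 3 4]]]]) auto
    then have "reaches ?P w (1 + 4 * Suc k) (0, \<lambda>_. 0) (1, st (Suc k) 1)"
      by (rule reaches_mono) simp
    then show ?case by simp
  qed
  have read: "reaches ?P w 1 (1, st n c) (2, st n 0)" for c
    using code len input_unary(2)
    by (intro reaches_instr[where i = "Read 3 1"]) (auto simp: st_def)
  have leave: "reaches ?P w 1 (2, st n 0) (5, st n 0)"
    using code len by (intro reaches_instr[where i = "JumpZero 3 5"]) (auto simp: st_def)
  have reg: "st n 0 0 = 0" "st n 0 1 = n" "st n 0 2 = 1"
    by (simp_all add: st_def)
  have "agree (st n 0) (st n 0)" by (simp add: agree_def)
  then obtain m where m: "reaches ?P w (poly (cost saturate) n) (5, st n 0) (5 + L, m)"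
    "agree m (sem w saturate (st n 0))"
    using compile_correct[OF main wf_saturate _ reg(1,3)] unfolding reg L_def by blast
  have "sound (st n 0)"
    by (simp add: sound_def st_def tbl_def)
  then have m8: "m 8 \<noteq> 0 \<longleftrightarrow> zero_cycle E"
    using saturate_correct m(2) by (simp add: agree_def)
  define h where "h = (if zero_cycle E then 6 + L else 7 + L)"
  have jump: "reaches ?P w 1 (5 + L, m) (h, m)"
    using code len m8 by (intro reaches_instr[where i = "JumpZero 8 (7 + L)"]) (auto simp: h_def)
  have "reaches ?P w (1 + 4 * n + (1 + (1 + (poly (cost saturate) n + 1)))) (0, \<lambda>_. 0) (h, m)"
    by (intro reaches_trans[OF count[OF order_refl]] reaches_trans[OF read] reaches_trans[OF leave]
        reaches_trans[OF m(1)] jump)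
  moreover
  define T where "T = poly ([:4, 4:] + cost saturate) (length w)"
  \<comment> \<open>The total is \<open>4 + 4 * n + poly (cost saturate) n\<close>; the unary prefix
    gives \<open>n \<le> length w\<close>, and polynomials with natural coefficients are
    monotone.\<close>
  have "1 + 4 * n + (1 + (1 + (poly (cost saturate) n + 1))) \<le> T"
  proof -
    have "n \<le> length w" by (simp add: length_encode)
    then show ?thesis
      using poly_mono_nat[of n "length w" "[:4, 4:] + cost saturate"] unfolding T_def by simp
  qed
  ultimately obtain k where k: "k \<le> T" "(step ?P w ^^ k) (0, \<lambda>_. 0) = (h, m)"
    unfolding reaches_def using le_trans by blast
  have h: "h < length ?P" "?P ! h = (if zero_cycle E then Reject else Accept)"
    using code len by (simp_all add: h_def)
  then have "step ?P w (h, m) = (h, m)"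
    by (simp add: step_def)
  then have stay: "(step ?P w ^^ i) (h, m) = (h, m)" for i
    by (induction i) auto
  \<comment> \<open>The halting configuration is a fixed point of \<open>step\<close>, so arrival
    within \<open>T\<close> steps means being there after exactly \<open>T\<close> steps.\<close>
  have "(step ?P w ^^ T) (0, \<lambda>_. 0) = (step ?P w ^^ (T - k)) ((step ?P w ^^ k) (0, \<lambda>_. 0))"
    using funpow_add[of "T - k" k "step ?P w"] k(1) by simp
  also have "\<dots> = (h, m)" unfolding k(2) by (rule stay)
  finally show ?thesis
    unfolding halts_within_def T_def[symmetric] using h by simp
qed

end

lemma dipaths_good_decidable_in_poly_time:
  "decidable_in_poly_time (presented_cycling_machines :: ('s machine \<times> 's list) set)
     encode_machine (\<lambda>(M, xs). \<forall>n \<ge> 1. good M (dipath n))"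
  unfolding decidable_in_poly_time_def
proof (intro exI ballI)
  fix x :: "'s machine \<times> 's list" assume x: "x \<in> presented_cycling_machines"
  obtain M xs where x_eq: "x = (M, xs)" by (cases x)
  interpret presented_machine M xs
    using x by unfold_locales (auto simp: x_eq presented_cycling_machines_def)
  have good: "(case x of (M, xs) \<Rightarrow> \<forall>n \<ge> 1. good M (dipath n)) \<longleftrightarrow> \<not> zero_cycle E"
    unfolding x_eq prod.case by (rule all_dipaths_good_iff)
  show "halts_within decision_program (encode_machine x)
      (poly ([:4, 4:] + cost saturate) (length (encode_machine x)))
      (if (\<lambda>(M, xs). \<forall>n \<ge> 1. good M (dipath n)) x then Accept else Reject)"
    unfolding good unfolding x_eq using decision_program_correct
    by (cases "zero_cycle E") (simp_all only: not_True_eq_False not_False_eq_True if_True if_False)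
qed

theorem theorem4:
  assumes "infinite (UNIV :: 'v set)"
  shows "(\<forall>M :: 's machine. two_machine M \<and> cycling M \<longrightarrow>
            ((\<forall>k :: nat. \<exists>G :: 'v pair_pre_digraph.
                pair_loopfree_digraph G \<and> good M G \<and> chromatic_number G \<ge> enat k)
             \<longleftrightarrow> (\<forall>n \<ge> 1. good M (dipath n)))) \<and>
         decidable_in_poly_time
           (presented_cycling_machines :: (nat machine \<times> nat list) set)
           encode_machine
           (\<lambda>(M, xs). \<forall>n \<ge> 1. good M (dipath n))"
proof (intro conjI allI impI, elim conjE)
  fix M :: "'s machine" assume "two_machine M"
  then show "(\<forall>k :: nat. \<exists>G :: 'v pair_pre_digraph.
      pair_loopfree_digraph G \<and> good M G \<and> chromatic_number G \<ge> enat k) \<longleftrightarrow>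
    (\<forall>n \<ge> 1. good M (dipath n))"
    by (rule large_chromatic_number_iff[OF assms])
qed (rule dipaths_good_decidable_in_poly_time)

end
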